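(* Let $n\ge 1$, and let $D\subseteq\mathbb{R}^n$ be either an open ball centered at the origin or $D=\mathbb{R}^n$. Let $M=\{(x,f(x)) : x\in D\}\subset\mathbb{R}^{n+1}$ be a smooth hypersurface which is the graph of a smooth radial function $f:D\to\mathbb{R}$ (that is, $f(x)$ depends only on $|x|$), equipped with the Riemannian metric induced from $\mathbb{R}^{n+1}$. If $M$ is geodesically complete, then the spectrum of the Laplace operator on $M$ is $\sigma(M)=[0,\infty)$.
   Context: For a complete Riemannian manifold $M$, $\Delta=\mathrm{div}\circ\mathrm{grad}$ acting on $C_0^\infty(M)$ (smooth functions with compact support) has a unique self-adjoint extension, still denoted $\Delta$, to an unbounded operator on $L^2(M)$ with domain $\{f\in L^2(M):\Delta f\in L^2(M)\}$. The spectrum of (the Laplace operator on) $M$, denoted $\sigma(M)$, is the spectrum of $-\Delta$, i.e. the set of $\lambda\ge 0$ such that $\Delta+\lambda I$ does not have a bounded inverse. *)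

theory Defs
  imports "HOL-Analysis.Analysis"
begin

section \<open>Smooth functions on open subsets of Euclidean space\<close>

definition partial_deriv ::
    "'n::finite \<Rightarrow> (real^'n \<Rightarrow> 'b::real_normed_vector) \<Rightarrow> real^'n \<Rightarrow> 'b" where
  "partial_deriv i u x = frechet_derivative u (at x) (axis i 1)"

text \<open>The predicates below are meant for an open set \<open>U\<close>; they then depend only on the
  restriction of the function to \<open>U\<close>.\<close>

primrec Ck_on ::
    "nat \<Rightarrow> (real^'n::finite) set \<Rightarrow> (real^'n \<Rightarrow> 'b::real_normed_vector) \<Rightarrow> bool" where
  "Ck_on 0 U u \<longleftrightarrow> continuous_on U u"
| "Ck_on (Suc k) U u \<longleftrightarrow>
     (\<forall>x\<in>U. u differentiable (at x)) \<and> (\<forall>i. Ck_on k U (partial_deriv i u))"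

definition smooth_on ::
    "(real^'n::finite) set \<Rightarrow> (real^'n \<Rightarrow> 'b::real_normed_vector) \<Rightarrow> bool" where
  "smooth_on U u \<longleftrightarrow> (\<forall>k. Ck_on k U u)"


section \<open>Riemannian metrics in coordinates\<close>

text \<open>A metric is given by its Gram matrix \<open>g x\<close> in the coordinates \<open>x\<close>.\<close>

definition christoffel ::
    "(real^'n::finite \<Rightarrow> real^'n^'n) \<Rightarrow> 'n \<Rightarrow> 'n \<Rightarrow> 'n \<Rightarrow> real^'n \<Rightarrow> real" where
  "christoffel g k i j x =
     (\<Sum>l\<in>UNIV. matrix_inv (g x) $ k $ l *
        (partial_deriv i (\<lambda>y. g y $ j $ l) x + partial_deriv j (\<lambda>y. g y $ i $ l) x
          - partial_deriv l (\<lambda>y. g y $ i $ j) x)) / 2"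

definition coord_geodesic ::
    "(real^'n::finite) set \<Rightarrow> (real^'n \<Rightarrow> real^'n^'n) \<Rightarrow> (real \<Rightarrow> real^'n) \<Rightarrow> bool" where
  "coord_geodesic U g c \<longleftrightarrow>
     (\<forall>t. c t \<in> U) \<and>
     (\<exists>v. (\<forall>t. (c has_vector_derivative v t) (at t)) \<and>
          (\<forall>t. (v has_vector_derivative
                 (\<chi> k. - (\<Sum>i\<in>UNIV. \<Sum>j\<in>UNIV. christoffel g k i j (c t) * v t $ i * v t $ j)))
               (at t)))"

definition coord_volume :: "(real^'n::finite \<Rightarrow> real^'n^'n) \<Rightarrow> real^'n \<Rightarrow> real" where
  "coord_volume g x = sqrt (det (g x))"

definition coord_grad ::
    "(real^'n::finite \<Rightarrow> real^'n^'n) \<Rightarrow> (real^'n \<Rightarrow> complex) \<Rightarrow> real^'n \<Rightarrow> complex^'n" where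
  "coord_grad g u x =
     (\<chi> i. \<Sum>j\<in>UNIV. (matrix_inv (g x) $ i $ j) *\<^sub>R partial_deriv j u x)"

definition coord_div ::
    "(real^'n::finite \<Rightarrow> real^'n^'n) \<Rightarrow> (real^'n \<Rightarrow> complex^'n) \<Rightarrow> real^'n \<Rightarrow> complex" where
  "coord_div g X x =
     (\<Sum>i\<in>UNIV. partial_deriv i (\<lambda>y. coord_volume g y *\<^sub>R (X y $ i)) x) /\<^sub>R coord_volume g x"

definition coord_laplacian ::
    "(real^'n::finite \<Rightarrow> real^'n^'n) \<Rightarrow> (real^'n \<Rightarrow> complex) \<Rightarrow> real^'n \<Rightarrow> complex" where
  "coord_laplacian g u = coord_div g (coord_grad g u)"


section \<open>Submanifolds of Euclidean space with a global parametrization\<close>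

text \<open>Here \<open>\<Phi>\<close> is an injective immersion of the open set \<open>U\<close>, a homeomorphism onto its image
  \<open>M = \<Phi> ` U\<close>. The manifold \<open>M\<close> carries the metric induced from the ambient space; functions and
  curves on \<open>M\<close> live in the ambient space, and the chart \<open>inv_into U \<Phi>\<close> is used to write down the
  differential operators.\<close>

definition induced_metric ::
    "(real^'n::finite \<Rightarrow> 'e::euclidean_space) \<Rightarrow> real^'n \<Rightarrow> real^'n^'n" where
  "induced_metric \<Phi> x = (\<chi> i j. partial_deriv i \<Phi> x \<bullet> partial_deriv j \<Phi> x)"

definition tangent_space ::
    "(real^'n::finite) set \<Rightarrow> (real^'n \<Rightarrow> 'e::euclidean_space) \<Rightarrow> 'e \<Rightarrow> 'e set" where
  "tangent_space U \<Phi> p = range (frechet_derivative \<Phi> (at (inv_into U \<Phi> p)))"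

definition geodesic ::
    "(real^'n::finite) set \<Rightarrow> (real^'n \<Rightarrow> 'e::euclidean_space) \<Rightarrow> (real \<Rightarrow> 'e) \<Rightarrow> bool" where
  "geodesic U \<Phi> \<gamma> \<longleftrightarrow>
     (\<exists>c. coord_geodesic U (induced_metric \<Phi>) c \<and> (\<forall>t. \<gamma> t = \<Phi> (c t)))"

definition geodesically_complete ::
    "(real^'n::finite) set \<Rightarrow> (real^'n \<Rightarrow> 'e::euclidean_space) \<Rightarrow> bool" where
  "geodesically_complete U \<Phi> \<longleftrightarrow>
     (\<forall>p\<in>\<Phi> ` U. \<forall>w\<in>tangent_space U \<Phi> p.
        \<exists>\<gamma>. geodesic U \<Phi> \<gamma> \<and> \<gamma> 0 = p \<and> (\<gamma> has_vector_derivative w) (at 0))"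

definition riemannian_measure ::
    "(real^'n::finite) set \<Rightarrow> (real^'n \<Rightarrow> 'e::euclidean_space) \<Rightarrow> 'e measure" where
  "riemannian_measure U \<Phi> =
     distr (density (restrict_space lborel U) (\<lambda>x. ennreal (coord_volume (induced_metric \<Phi>) x)))
       (restrict_space borel (\<Phi> ` U)) \<Phi>"

definition laplacian ::
    "(real^'n::finite) set \<Rightarrow> (real^'n \<Rightarrow> 'e::euclidean_space) \<Rightarrow> ('e \<Rightarrow> complex) \<Rightarrow> 'e \<Rightarrow> complex"
  where
  "laplacian U \<Phi> u p = coord_laplacian (induced_metric \<Phi>) (u \<circ> \<Phi>) (inv_into U \<Phi> p)"

definition test_functions ::
    "(real^'n::finite) set \<Rightarrow> (real^'n \<Rightarrow> 'e::euclidean_space) \<Rightarrow> ('e \<Rightarrow> complex) set" where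
  "test_functions U \<Phi> =
     {\<phi>. smooth_on U (\<phi> \<circ> \<Phi>) \<and> (\<exists>K. compact K \<and> K \<subseteq> \<Phi> ` U \<and> (\<forall>p\<in>\<Phi> ` U - K. \<phi> p = 0))}"


section \<open>Square-integrable functions and operators on them\<close>

text \<open>Elements of \<open>L\<^sup>2\<close> are represented by functions; equality in \<open>L\<^sup>2\<close> is equality almost
  everywhere.\<close>

definition L2 :: "'a measure \<Rightarrow> ('a \<Rightarrow> complex) set" where
  "L2 \<mu> = {u \<in> borel_measurable \<mu>. integrable \<mu> (\<lambda>p. (norm (u p))\<^sup>2)}"

definition L2_norm :: "'a measure \<Rightarrow> ('a \<Rightarrow> complex) \<Rightarrow> real" where
  "L2_norm \<mu> u = sqrt (\<integral>p. (norm (u p))\<^sup>2 \<partial>\<mu>)"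

definition L2_bounded_operator ::
    "'a measure \<Rightarrow> (('a \<Rightarrow> complex) \<Rightarrow> ('a \<Rightarrow> complex)) \<Rightarrow> bool" where
  "L2_bounded_operator \<mu> S \<longleftrightarrow>
     (\<forall>h\<in>L2 \<mu>. S h \<in> L2 \<mu>) \<and>
     (\<forall>h\<in>L2 \<mu>. \<forall>k\<in>L2 \<mu>. (AE p in \<mu>. h p = k p) \<longrightarrow> (AE p in \<mu>. S h p = S k p)) \<and>
     (\<forall>h\<in>L2 \<mu>. \<forall>k\<in>L2 \<mu>. AE p in \<mu>. S (\<lambda>q. h q + k q) p = S h p + S k p) \<and>
     (\<forall>a. \<forall>h\<in>L2 \<mu>. AE p in \<mu>. S (\<lambda>q. a * h q) p = a * S h p) \<and>
     (\<exists>C. \<forall>h\<in>L2 \<mu>. L2_norm \<mu> (S h) \<le> C * L2_norm \<mu> h)"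

text \<open>An unbounded operator is given by its graph: \<open>A u h\<close> says that \<open>u\<close> lies in the domain and
  is mapped to \<open>h\<close>.\<close>

definition has_bounded_inverse ::
    "'a measure \<Rightarrow> (('a \<Rightarrow> complex) \<Rightarrow> ('a \<Rightarrow> complex) \<Rightarrow> bool) \<Rightarrow> bool" where
  "has_bounded_inverse \<mu> A \<longleftrightarrow>
     (\<exists>S. L2_bounded_operator \<mu> S \<and>
          (\<forall>h\<in>L2 \<mu>. A (S h) h) \<and>
          (\<forall>u h. A u h \<longrightarrow> (AE p in \<mu>. S h p = u p)))"


section \<open>The spectrum of the Laplace operator\<close>

text \<open>The operator \<open>\<Delta>\<close> on \<open>{u \<in> L\<^sup>2(M). \<Delta>u \<in> L\<^sup>2(M)}\<close>, where \<open>\<Delta>u\<close> is taken in the sense of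
  distributions. For complete \<open>M\<close> this is the unique self-adjoint extension of \<open>\<Delta>\<close> from the
  smooth compactly supported functions.\<close>

definition L2_laplacian ::
    "(real^'n::finite) set \<Rightarrow> (real^'n \<Rightarrow> 'e::euclidean_space) \<Rightarrow>
      ('e \<Rightarrow> complex) \<Rightarrow> ('e \<Rightarrow> complex) \<Rightarrow> bool" where
  "L2_laplacian U \<Phi> u h \<longleftrightarrow>
     u \<in> L2 (riemannian_measure U \<Phi>) \<and> h \<in> L2 (riemannian_measure U \<Phi>) \<and>
     (\<forall>\<phi>\<in>test_functions U \<Phi>.
        (\<integral>p. u p * laplacian U \<Phi> \<phi> p \<partial>riemannian_measure U \<Phi>) =
        (\<integral>p. h p * \<phi> p \<partial>riemannian_measure U \<Phi>))"

definition shifted_laplacian ::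
    "(real^'n::finite) set \<Rightarrow> (real^'n \<Rightarrow> 'e::euclidean_space) \<Rightarrow> real \<Rightarrow>
      ('e \<Rightarrow> complex) \<Rightarrow> ('e \<Rightarrow> complex) \<Rightarrow> bool" where
  "shifted_laplacian U \<Phi> l u h \<longleftrightarrow>
     (\<exists>w. L2_laplacian U \<Phi> u w \<and> h = (\<lambda>p. w p + complex_of_real l * u p))"

definition laplace_spectrum ::
    "(real^'n::finite) set \<Rightarrow> (real^'n \<Rightarrow> 'e::euclidean_space) \<Rightarrow> real set" where
  "laplace_spectrum U \<Phi> =
     {l. 0 \<le> l \<and> \<not> has_bounded_inverse (riemannian_measure U \<Phi>) (shifted_laplacian U \<Phi> l)}"


section \<open>Graphs\<close>

definition graph_map :: "(real^'n::finite \<Rightarrow> real) \<Rightarrow> real^'n \<Rightarrow> (real^'n) \<times> real" where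
  "graph_map f x = (x, f x)"

definition radial_on :: "(real^'n::finite) set \<Rightarrow> (real^'n \<Rightarrow> real) \<Rightarrow> bool" where
  "radial_on D f \<longleftrightarrow> (\<forall>x\<in>D. \<forall>y\<in>D. norm x = norm y \<longrightarrow> f x = f y)"

end

(* The metric on the graph is w(r)^2 dr^2 + r^2 d\<theta>^2 with w = sqrt (1 + f'^2), so completeness means
   that the arc length s(r) = \<integral>_0^r w of the profile curve is unbounded: a geodesic that starts radially stays
   radial by conservation of angular momentum and energy, and s grows linearly along it. For a C^2 function H the
   radial function u = H(s(|x|)) satisfies \<Delta>u = H'' + (n - 1) / (r w) H'. Take for H a wave
   packet of frequency sqrt \<lambda> supported in a window [s(a), s(a) + L] with end radii a \<le> b \<le> 2a. On the
   window the volume density r^(n-1) w dr is comparable to a^(n-1) ds, and the integral of (1/(r w))^2 ds is at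
   most that of dr/r^2, hence at most 1/a. So \<parallel>\<Delta>u + \<lambda>u\<parallel>^2 / \<parallel>u\<parallel>^2 = O(1/L^2 + 1/(a L)), which tends to 0 as
   L \<rightarrow> \<infinity> if a stays away from 0; thus \<Delta> + \<lambda> has no bounded inverse. Since test functions only occur on one
   side of Green's formula, C^2 wave packets suffice. *)

theory Submission
  imports Defs
begin

section \<open>Continuously differentiable functions and integration by parts\<close>

text \<open>Why no curvature bound enters: the Laplacian is used in divergence form, and by w^2 -
  f'^2 = 1 the flux of u = H(s(|x|)) is H'(s) x / |x|. Here w has cancelled, so w is never
  differentiated and only the final division by w remains. The origin of the windows depends on D.
  If D = R^n, then w \<ge> 1 makes the arc length between the radii L and 2L at least L. In a ball
  of radius R every window starts at R / 2 and ends before R; unbounded arc length makes it fit for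
  every L. The obstacle is the origin, where the norm is not differentiable. Packets vanish on a
  ball around it, so the formulas from D - {0} are glued with 0 there. A geodesic, in contrast, has
  to be shown never to return to it. No limit is taken at the end: a bounded inverse yields ||u||
  \<le> C ||\<Delta>u + \<lambda>u||, and after squaring, the left side is at least a constant times
  a^(n-1) L while the right side is at most a constant times a^(n-1), so one explicit L is
  contradictory.\<close>

lemma partial_deriv_eq:
  "(u has_derivative D) (at x) \<Longrightarrow> partial_deriv i u x = D (axis i 1)"
  unfolding partial_deriv_def using frechet_derivative_at by metis

text \<open>Holds at points of non-differentiability too: \<open>frechet_derivative\<close> is a
  choice among all derivatives at the point, and \<open>u\<close> and \<open>v\<close> have the same
  ones at \<open>x\<close>.\<close>

lemma partial_deriv_cong:
  assumes "open U" "x \<in> U" "\<And>y. y \<in> U \<Longrightarrow> u y = v y"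
  shows "partial_deriv i u x = partial_deriv i v x"
proof -
  have "(u has_derivative D) (at x) \<longleftrightarrow> (v has_derivative D) (at x)" for D
    using assms has_derivative_transform_within_open[of u D x UNIV U v]
      has_derivative_transform_within_open[of v D x UNIV U u] by auto
  then show ?thesis
    by (simp add: partial_deriv_def frechet_derivative_def)
qed

lemma C1_onI:
  assumes "\<And>x. x \<in> U \<Longrightarrow> (u has_derivative u' x) (at x)"
    and "\<And>i. continuous_on U (\<lambda>x. u' x (axis i 1))"
  shows "Ck_on (Suc 0) U u"
proof -
  have "continuous_on U (partial_deriv i u)" for i
    using assms(2)[of i] by (rule continuous_on_eq) (simp add: partial_deriv_eq[OF assms(1)])
  moreover have "u differentiable (at x)" if "x \<in> U" for x
    using assms(1)[OF that] by (rule differentiableI)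
  ultimately show ?thesis by simp
qed

lemma C1_on_differentiable: "Ck_on (Suc 0) U u \<Longrightarrow> x \<in> U \<Longrightarrow> u differentiable (at x)"
  by simp

lemma C1_on_continuous_partial: "Ck_on (Suc 0) U u \<Longrightarrow> continuous_on U (partial_deriv i u)"
  by simp

lemma C1_on_continuous:
  assumes "Ck_on (Suc 0) U u" shows "continuous_on U u"
proof -
  have "u differentiable (at x within U)" if "x \<in> U" for x
    using C1_on_differentiable[OF assms that] by (rule differentiable_at_withinI)
  then show ?thesis
    by (intro differentiable_imp_continuous_on) (auto simp: differentiable_on_def)
qed

lemma has_derivative_partials:
  fixes u :: "real^'n::finite \<Rightarrow> 'b::real_normed_vector"
  assumes "u differentiable (at x)"
  shows "(u has_derivative (\<lambda>h. \<Sum>i\<in>UNIV. h $ i *\<^sub>R partial_deriv i u x)) (at x)"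
proof -
  let ?D = "frechet_derivative u (at x)"
  have D: "(u has_derivative ?D) (at x)"
    using assms frechet_derivative_works by blast
  interpret linear ?D using D by (rule has_derivative_linear)
  have "?D h = (\<Sum>i\<in>UNIV. h $ i *\<^sub>R partial_deriv i u x)" for h
  proof -
    have "?D h = ?D (\<Sum>i\<in>UNIV. h $ i *s axis i 1)" by (simp add: basis_expansion)
    also have "\<dots> = (\<Sum>i\<in>UNIV. h $ i *\<^sub>R ?D (axis i 1))"
      by (simp add: sum scale scalar_mult_eq_scaleR)
    finally show ?thesis by (simp add: partial_deriv_def)
  qed
  then show ?thesis using D by presburger
qed

lemma C1_on_has_derivative:
  "Ck_on (Suc 0) U u \<Longrightarrow> x \<in> U \<Longrightarrow>
    (u has_derivative (\<lambda>h. \<Sum>i\<in>UNIV. h $ i *\<^sub>R partial_deriv i u x)) (at x)"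
  by (simp add: has_derivative_partials)

text \<open>Evaluates at a basis vector a derivative that is written through partial derivatives, as
  in \<open>has_derivative_partials\<close>.\<close>

lemma sum_axis_scaleR: "(\<Sum>j\<in>UNIV. axis i (1::real) $ j *\<^sub>R a j) = (a i :: 'b::real_normed_vector)"
proof -
  have "(\<Sum>j\<in>UNIV. axis i (1::real) $ j *\<^sub>R a j) = (\<Sum>j\<in>UNIV. if j = i then a j else 0)"
    by (rule sum.cong) (auto simp: axis_def)
  then show ?thesis by simp
qed

text \<open>An arbitrary bounded bilinear \<open>m\<close> lets one proof serve both real scalars
  times complex functions and products of complex functions.\<close>

lemma has_derivative_bilinear:
  fixes u :: "real^'n::finite \<Rightarrow> 'a::real_normed_vector"
  assumes "bounded_bilinear m" "Ck_on (Suc 0) U u" "Ck_on (Suc 0) U v" "x \<in> U"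
  shows "((\<lambda>x. m (u x) (v x)) has_derivative
      (\<lambda>h. m (u x) (\<Sum>i\<in>UNIV. h $ i *\<^sub>R partial_deriv i v x)
         + m (\<Sum>i\<in>UNIV. h $ i *\<^sub>R partial_deriv i u x) (v x))) (at x)"
  using bounded_bilinear.FDERIV[OF assms(1) C1_on_has_derivative[OF assms(2,4)]
      C1_on_has_derivative[OF assms(3,4)]] .

lemma partial_deriv_bilinear:
  fixes u :: "real^'n::finite \<Rightarrow> 'a::real_normed_vector"
  assumes "bounded_bilinear m" "Ck_on (Suc 0) U u" "Ck_on (Suc 0) U v" "x \<in> U"
  shows "partial_deriv i (\<lambda>x. m (u x) (v x)) x
       = m (u x) (partial_deriv i v x) + m (partial_deriv i u x) (v x)"
  by (simp add: partial_deriv_eq[OF has_derivative_bilinear[OF assms]] sum_axis_scaleR)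

lemma C1_on_bilinear:
  fixes u :: "real^'n::finite \<Rightarrow> 'a::real_normed_vector"
  assumes "bounded_bilinear m" "Ck_on (Suc 0) U u" "Ck_on (Suc 0) U v"
  shows "Ck_on (Suc 0) U (\<lambda>x. m (u x) (v x))"
proof (rule C1_onI[OF has_derivative_bilinear[OF assms]])
  fix i
  show "continuous_on U (\<lambda>x. m (u x) (\<Sum>j\<in>UNIV. axis i (1::real) $ j *\<^sub>R partial_deriv j v x)
         + m (\<Sum>j\<in>UNIV. axis i (1::real) $ j *\<^sub>R partial_deriv j u x) (v x))"
    unfolding sum_axis_scaleR
    by (intro continuous_on_add bounded_bilinear.continuous_on[OF assms(1)]
        C1_on_continuous[OF assms(2)] C1_on_continuous[OF assms(3)]
        C1_on_continuous_partial[OF assms(2)] C1_on_continuous_partial[OF assms(3)])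
qed

lemmas C1_on_scaleR = C1_on_bilinear[OF bounded_bilinear_scaleR]
lemmas C1_on_mult = C1_on_bilinear[OF bounded_bilinear_mult]

lemma C1_on_const: "Ck_on (Suc 0) U (\<lambda>x. c)"
  by (rule C1_onI[of U _ "\<lambda>_ _. 0"]) auto

lemma C1_on_add:
  assumes "Ck_on (Suc 0) U u" "Ck_on (Suc 0) U v"
  shows "Ck_on (Suc 0) U (\<lambda>x. u x + v x)"
proof (rule C1_onI)
  show "((\<lambda>x. u x + v x) has_derivative
     (\<lambda>h. (\<Sum>i\<in>UNIV. h $ i *\<^sub>R partial_deriv i u x) + (\<Sum>i\<in>UNIV. h $ i *\<^sub>R partial_deriv i v x))) (at x)"
    if "x \<in> U" for x
    by (intro has_derivative_add C1_on_has_derivative[OF assms(1) that] C1_on_has_derivative[OF assms(2) that])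
  show "continuous_on U (\<lambda>x. (\<Sum>j\<in>UNIV. axis i (1::real) $ j *\<^sub>R partial_deriv j u x)
      + (\<Sum>j\<in>UNIV. axis i (1::real) $ j *\<^sub>R partial_deriv j v x))" for i
    unfolding sum_axis_scaleR
    by (intro continuous_on_add C1_on_continuous_partial[OF assms(1)] C1_on_continuous_partial[OF assms(2)])
qed

lemma C1_on_sum:
  assumes "\<And>a. a \<in> A \<Longrightarrow> Ck_on (Suc 0) U (u a)"
  shows "Ck_on (Suc 0) U (\<lambda>x. \<Sum>a\<in>A. u a x)"
  using assms
proof (induction A rule: infinite_finite_induct)
  case (insert a A)
  have "Ck_on (Suc 0) U (\<lambda>x. u a x + (\<Sum>a\<in>A. u a x))"
    by (rule C1_on_add) (use insert in auto)
  then show ?case by (simp only: sum.insert[OF insert.hyps])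
qed (simp_all del: Ck_on.simps add: C1_on_const)

lemma C1_on_uminus: "Ck_on (Suc 0) U u \<Longrightarrow> Ck_on (Suc 0) U (\<lambda>x. - u x)"
  using C1_on_scaleR[OF C1_on_const[of U "-1"], of u] by (simp only: scaleR_minus1_left)

lemma C1_on_diff:
  "Ck_on (Suc 0) U u \<Longrightarrow> Ck_on (Suc 0) U v \<Longrightarrow> Ck_on (Suc 0) U (\<lambda>x. u x - v x)"
  using C1_on_add[OF _ C1_on_uminus, of U u v] by (simp only: diff_conv_add_uminus)

text \<open>\<open>T\<close> contains the values of \<open>u\<close>, so that functions which are
  differentiable on part of the line only, such as \<open>sqrt\<close>, \<open>inverse\<close> or
  \<open>arc_length\<close>, can be composed.\<close>

lemma C1_on_compose:
  fixes u :: "real^'n::finite \<Rightarrow> real" and H :: "real \<Rightarrow> 'b::real_normed_vector"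
  assumes "Ck_on (Suc 0) U u" "\<And>x. x \<in> U \<Longrightarrow> u x \<in> T"
    and H: "\<And>t. t \<in> T \<Longrightarrow> (H has_vector_derivative H' t) (at t)" "continuous_on T H'"
  shows "Ck_on (Suc 0) U (\<lambda>x. H (u x))"
    and "x \<in> U \<Longrightarrow> partial_deriv i (\<lambda>x. H (u x)) x = partial_deriv i u x *\<^sub>R H' (u x)"
proof -
  have D: "((\<lambda>x. H (u x)) has_derivative
      (\<lambda>h. (\<Sum>i\<in>UNIV. h $ i *\<^sub>R partial_deriv i u x) *\<^sub>R H' (u x))) (at x)" if "x \<in> U" for x
    using has_derivative_compose[OF C1_on_has_derivative[OF assms(1) that]
        H(1)[OF assms(2)[OF that], unfolded has_vector_derivative_def]] .
  show "Ck_on (Suc 0) U (\<lambda>x. H (u x))"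
  proof (rule C1_onI[OF D])
    have "continuous_on U (\<lambda>x. H' (u x))"
      by (rule continuous_on_compose2[OF H(2) C1_on_continuous[OF assms(1)]]) (use assms(2) in auto)
    then show "continuous_on U (\<lambda>x. (\<Sum>j\<in>UNIV. axis i (1::real) $ j *\<^sub>R partial_deriv j u x) *\<^sub>R H' (u x))" for i
      unfolding sum_axis_scaleR
      by (intro continuous_on_scaleR C1_on_continuous_partial[OF assms(1)])
  qed
  show "partial_deriv i (\<lambda>x. H (u x)) x = partial_deriv i u x *\<^sub>R H' (u x)" if "x \<in> U"
    unfolding partial_deriv_eq[OF D[OF that]] sum_axis_scaleR ..
qed

lemma C1_on_subset: "Ck_on (Suc 0) U u \<Longrightarrow> V \<subseteq> U \<Longrightarrow> Ck_on (Suc 0) V u"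
  by (auto intro: continuous_on_subset)

lemma C1_on_cong:
  assumes "open U" "Ck_on (Suc 0) U u" "\<And>x. x \<in> U \<Longrightarrow> u x = v x"
  shows "Ck_on (Suc 0) U v"
proof (rule C1_onI)
  show "(v has_derivative (\<lambda>h. \<Sum>i\<in>UNIV. h $ i *\<^sub>R partial_deriv i u x)) (at x)" if "x \<in> U" for x
    using C1_on_has_derivative[OF assms(2) that] assms(1) that assms(3)
    by (rule has_derivative_transform_within_open)
  show "continuous_on U (\<lambda>x. \<Sum>j\<in>UNIV. axis i (1::real) $ j *\<^sub>R partial_deriv j u x)" for i
    unfolding sum_axis_scaleR by (rule C1_on_continuous_partial[OF assms(2)])
qed

lemma C1_on_Un:
  assumes "open U" "open V" "Ck_on (Suc 0) U u" "Ck_on (Suc 0) V u"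
  shows "Ck_on (Suc 0) (U \<union> V) u"
  using assms by (auto intro: continuous_on_open_Un)

text \<open>\<open>U\<close> and the complement of \<open>K\<close> are open and cover the space,
  and on the latter the extension is identically 0.\<close>

lemma C1_on_extend_zero:
  fixes u :: "real^'n::finite \<Rightarrow> 'b::real_normed_vector"
  assumes "open U" "compact K" "K \<subseteq> U" "Ck_on (Suc 0) U u" "\<And>x. x \<in> U - K \<Longrightarrow> u x = 0"
  shows "Ck_on (Suc 0) UNIV (\<lambda>x. if x \<in> U then u x else 0)"
proof -
  let ?v = "\<lambda>x. if x \<in> U then u x else 0"
  have "Ck_on (Suc 0) U ?v"
    by (rule C1_on_cong[OF assms(1,4)]) simp
  moreover have "Ck_on (Suc 0) (- K) ?v"
    by (rule C1_on_cong[OF _ C1_on_const[of _ 0]]) (use assms compact_imp_closed in auto)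
  ultimately have "Ck_on (Suc 0) (U \<union> - K) ?v"
    using assms compact_imp_closed by (intro C1_on_Un) auto
  moreover have "U \<union> - K = UNIV" using assms by auto
  ultimately show ?thesis by simp
qed

section \<open>Integrals of partial derivatives of compactly supported functions\<close>

lemma lborel_integral_translate:
  fixes F :: "'a::euclidean_space \<Rightarrow> 'b::{banach, second_countable_topology}"
  assumes "F \<in> borel_measurable borel"
  shows "(\<integral>x. F (c + x) \<partial>lborel) = (\<integral>x. F x \<partial>lborel)"
proof -
  have "(\<integral>x. F x \<partial>lborel) = (\<integral>x. F x \<partial>distr lborel borel ((+) c))"
    by (simp add: lborel_distr_plus)
  also have "\<dots> = (\<integral>x. F (c + x) \<partial>lborel)"
    by (subst integral_distr) (use assms in auto)
  finally show ?thesis by simp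
qed

lemma integrable_compact_support:
  fixes F :: "'a::euclidean_space \<Rightarrow> 'b::{banach, second_countable_topology}"
  assumes "continuous_on UNIV F" "compact K" "\<And>x. x \<notin> K \<Longrightarrow> F x = 0"
  shows "integrable lborel F"
proof -
  have "integrable lborel (\<lambda>x. indicator K x *\<^sub>R F x)"
    by (rule borel_integrable_compact[OF assms(2) continuous_on_subset[OF assms(1)]]) auto
  moreover have "(\<lambda>x. indicator K x *\<^sub>R F x) = F"
    using assms(3) by (auto simp: indicator_def fun_eq_iff)
  ultimately show ?thesis by simp
qed

lemma partial_deriv_zero_outside:
  assumes "compact K" "x \<notin> K" "\<And>x. x \<notin> K \<Longrightarrow> F x = 0"
  shows "partial_deriv i F x = 0"
proof -
  have "partial_deriv i F x = partial_deriv i (\<lambda>_. 0) x"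
    by (rule partial_deriv_cong[of "- K"]) (use assms compact_imp_closed in auto)
  then show ?thesis by (simp add: partial_deriv_def)
qed

lemma has_vector_derivative_imp_quotient_tendsto:
  assumes "(f has_vector_derivative f') (at t)"
  shows "((\<lambda>h. (f (t + h) - f t) /\<^sub>R h) \<longlongrightarrow> f') (at 0)"
proof -
  have "((\<lambda>h. norm (f (t + h) - f t - h *\<^sub>R f') / norm h) \<longlongrightarrow> 0) (at 0)"
    using assms by (simp add: has_vector_derivative_def has_derivative_at)
  moreover have "\<forall>\<^sub>F h in at 0. norm (f (t + h) - f t - h *\<^sub>R f') / norm h
      = norm ((f (t + h) - f t) /\<^sub>R h - f')"
  proof (rule eventually_at_topological[THEN iffD2], intro exI[of _ UNIV] conjI ballI impI)
    fix h :: real assume "h \<noteq> 0"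
    then have "(f (t + h) - f t) /\<^sub>R h - f' = (f (t + h) - f t - h *\<^sub>R f') /\<^sub>R h"
      by (simp add: algebra_simps)
    then show "norm (f (t + h) - f t - h *\<^sub>R f') / norm h = norm ((f (t + h) - f t) /\<^sub>R h - f')"
      by (simp add: divide_inverse mult.commute)
  qed auto
  ultimately have "((\<lambda>h. norm ((f (t + h) - f t) /\<^sub>R h - f')) \<longlongrightarrow> 0) (at 0)"
    by (rule Lim_transform_eventually)
  then show ?thesis
    by (rule LIM_zero_cancel[OF tendsto_norm_zero_cancel])
qed

text \<open>Translation invariance replaces Fubini and the fundamental theorem: the difference
  quotients \<open>q k\<close> in direction \<open>i\<close> integrate to 0, and they converge to
  the partial derivative, dominated by the constant \<open>B\<close> on a fixed ball.\<close>

lemma integral_partial_deriv_eq_0: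
  fixes F :: "real^'n::finite \<Rightarrow> 'b::{banach, second_countable_topology}"
  assumes "Ck_on (Suc 0) UNIV F" "compact K" "\<And>x. x \<notin> K \<Longrightarrow> F x = 0"
  shows "(\<integral>x. partial_deriv i F x \<partial>lborel) = 0"
proof -
  let ?P = "partial_deriv i F" and ?e = "axis i 1 :: real^'n"
  define q where "q k x = (real (Suc k)) *\<^sub>R (F (?e /\<^sub>R real (Suc k) + x) - F x)" for k x
  have contF: "continuous_on UNIV F" using C1_on_continuous[OF assms(1)] .
  have contP: "continuous_on UNIV ?P" using C1_on_continuous_partial[OF assms(1)] .
  have mF[measurable]: "F \<in> borel_measurable borel" using contF by (rule borel_measurable_continuous_onI)
  have mP: "?P \<in> borel_measurable borel" using contP by (rule borel_measurable_continuous_onI)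
  have P0: "?P x = 0" if "x \<notin> K" for x
    by (rule partial_deriv_zero_outside[OF assms(2) that assms(3)])
  obtain B where B: "\<And>x. norm (?P x) \<le> B"
  proof -
    have "bounded (?P ` K)"
      by (intro compact_imp_bounded compact_continuous_image continuous_on_subset[OF contP] assms) auto
    then obtain B where "\<And>x. x \<in> K \<Longrightarrow> norm (?P x) \<le> B" by (auto simp: bounded_iff)
    then have "norm (?P x) \<le> max B 0" for x
      using P0[of x] by (cases "x \<in> K") (auto simp: le_max_iff_disj)
    then show ?thesis using that by blast
  qed
  obtain r where r: "\<And>x. x \<in> K \<Longrightarrow> norm x \<le> r"
    using compact_imp_bounded[OF assms(2)] by (auto simp: bounded_iff)
  have line: "((\<lambda>t. F (t *\<^sub>R ?e + x)) has_vector_derivative ?P (t *\<^sub>R ?e + x)) (at t)" for t x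
  proof -
    have "((\<lambda>t. t *\<^sub>R ?e + x) has_derivative (\<lambda>h. h *\<^sub>R ?e)) (at t)"
      by (auto intro!: derivative_eq_intros)
    from has_derivative_compose[OF this C1_on_has_derivative[OF assms(1) UNIV_I]]
    have "((\<lambda>t. F (t *\<^sub>R ?e + x)) has_derivative
       (\<lambda>h. \<Sum>j\<in>UNIV. (h *\<^sub>R ?e) $ j *\<^sub>R partial_deriv j F (t *\<^sub>R ?e + x))) (at t)" .
    moreover have "(\<Sum>j\<in>UNIV. (h *\<^sub>R ?e) $ j *\<^sub>R partial_deriv j F y) = h *\<^sub>R ?P y" for h y
    proof -
      have "(\<Sum>j\<in>UNIV. (h *\<^sub>R ?e) $ j *\<^sub>R partial_deriv j F y)
         = h *\<^sub>R (\<Sum>j\<in>UNIV. ?e $ j *\<^sub>R partial_deriv j F y)"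
        by (simp add: scaleR_sum_right)
      then show ?thesis by (simp add: sum_axis_scaleR)
    qed
    ultimately show ?thesis by (simp add: has_vector_derivative_def)
  qed
  have qB: "norm (q k x) \<le> B" for k x
  proof -
    let ?h = "inverse (real (Suc k))"
    have "norm (F (?h *\<^sub>R ?e + x) - F (0 *\<^sub>R ?e + x)) \<le> B * norm (?h - 0)"
    proof (rule differentiable_bound[where S = UNIV and f = "\<lambda>t. F (t *\<^sub>R ?e + x)"
          and f' = "\<lambda>t h. h *\<^sub>R ?P (t *\<^sub>R ?e + x)"])
      show "((\<lambda>t. F (t *\<^sub>R ?e + x)) has_derivative (\<lambda>h. h *\<^sub>R ?P (t *\<^sub>R ?e + x))) (at t within UNIV)" for t
        using line[of x t] by (simp add: has_vector_derivative_def)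
      show "onorm (\<lambda>h. h *\<^sub>R ?P (t *\<^sub>R ?e + x)) \<le> B" for t
        using B by (intro onorm_le) (auto simp: mult.commute[of B] intro!: mult_left_mono)
    qed auto
    then have "real (Suc k) * norm (F (?h *\<^sub>R ?e + x) - F x) \<le> real (Suc k) * (B * ?h)"
      by (intro mult_left_mono) auto
    also have "real (Suc k) * (B * ?h) = B" by simp
    finally show ?thesis by (simp add: q_def del: of_nat_Suc)
  qed
  \<comment> \<open>The translations have length \<open>1 / Suc k\<close>, hence at most 1, so
    enlarging the radius of the support by 1 serves all \<open>k\<close> at once.\<close>
  have q0: "q k x = 0" if "x \<notin> cball 0 (r + 1)" for k x
  proof -
    have "norm (?e /\<^sub>R real (Suc k)) \<le> 1"
      by (simp add: inverse_le_1_iff)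
    then have "norm x \<le> norm (?e /\<^sub>R real (Suc k) + x) + 1"
      using norm_triangle_ineq4[of "?e /\<^sub>R real (Suc k) + x" "?e /\<^sub>R real (Suc k)"] by simp
    moreover have "norm x > r + 1" using that by auto
    ultimately have "norm (?e /\<^sub>R real (Suc k) + x) > r" "norm x > r" by linarith+
    then have "?e /\<^sub>R real (Suc k) + x \<notin> K" "x \<notin> K" using r by force+
    then show ?thesis using assms(3) by (simp add: q_def)
  qed
  have intF: "integrable lborel F" by (rule integrable_compact_support[OF contF assms(2,3)])
  have q_int: "(\<integral>x. q k x \<partial>lborel) = 0" for k
  proof -
    let ?c = "?e /\<^sub>R real (Suc k)"
    have "integrable lborel (\<lambda>x. F (?c + x))"
    proof (rule integrable_compact_support)
      show "continuous_on UNIV (\<lambda>x. F (?c + x))"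
        by (rule continuous_on_compose2[OF contF]) (auto intro!: continuous_intros)
      show "compact ((\<lambda>x. x - ?c) ` K)"
        by (intro compact_continuous_image assms continuous_intros)
      show "F (?c + x) = 0" if "x \<notin> (\<lambda>x. x - ?c) ` K" for x
      proof (rule assms(3), rule notI)
        assume "?c + x \<in> K"
        then have "(?c + x) - ?c \<in> (\<lambda>x. x - ?c) ` K" by (rule imageI)
        then show False using that by simp
      qed
    qed
    then show ?thesis
      unfolding q_def
      by (subst integral_scaleR_right)
         (simp add: Bochner_Integration.integral_diff[OF _ intF] lborel_integral_translate)
  qed
  have "(\<lambda>k. \<integral>x. q k x \<partial>lborel) \<longlonglongrightarrow> (\<integral>x. ?P x \<partial>lborel)"
  proof (rule integral_dominated_convergence[where w = "\<lambda>x. indicator (cball 0 (r + 1)) x * B"])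
    show "?P \<in> borel_measurable lborel" using mP by simp
    show "q k \<in> borel_measurable lborel" for k unfolding q_def by measurable
    show "integrable lborel (\<lambda>x::real^'n. indicator (cball 0 (r + 1)) x * B)"
      using borel_integrable_compact[of "cball 0 (r + 1) :: (real^'n) set" "\<lambda>_. B"] by auto
    show "AE x in lborel. norm (q k x) \<le> indicator (cball 0 (r + 1)) x * B" for k
    proof (rule AE_I2)
      fix x show "norm (q k x) \<le> indicator (cball 0 (r + 1)) x * B"
        using qB[of k x] q0[of x k] by (cases "x \<in> cball 0 (r + 1)") auto
    qed
    show "AE x in lborel. (\<lambda>k. q k x) \<longlonglongrightarrow> ?P x"
    proof (rule AE_I2)
      fix x
      have "((\<lambda>h. (F (h *\<^sub>R ?e + x) - F x) /\<^sub>R h) \<longlongrightarrow> ?P x) (at 0)"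
        using has_vector_derivative_imp_quotient_tendsto[OF line[of x 0]] by simp
      moreover have "filterlim (\<lambda>k. inverse (real (Suc k))) (at 0) sequentially"
        using LIMSEQ_inverse_real_of_nat by (auto simp: filterlim_at)
      ultimately have "(\<lambda>k. (F (inverse (real (Suc k)) *\<^sub>R ?e + x) - F x) /\<^sub>R inverse (real (Suc k)))
          \<longlonglongrightarrow> ?P x"
        by (rule filterlim_compose)
      then show "(\<lambda>k. q k x) \<longlonglongrightarrow> ?P x" by (simp add: q_def)
    qed
  qed
  then have "(\<lambda>k. 0) \<longlonglongrightarrow> (\<integral>x. ?P x \<partial>lborel)" unfolding q_int .
  then show ?thesis using LIMSEQ_unique tendsto_const by blast
qed

section \<open>Integration by parts and Green's formula\<close>

lemma set_integrable_compact_support: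
  fixes F :: "'a::euclidean_space \<Rightarrow> 'b::{banach, second_countable_topology}"
  assumes "continuous_on U F" "compact K" "K \<subseteq> U" "\<And>x. x \<in> U - K \<Longrightarrow> F x = 0"
  shows "set_integrable lborel U F"
proof -
  have "integrable lborel (\<lambda>x. indicator K x *\<^sub>R F x)"
    by (rule borel_integrable_compact[OF assms(2) continuous_on_subset[OF assms(1,3)]])
  moreover have "(\<lambda>x. indicator K x *\<^sub>R F x) = (\<lambda>x. indicator U x *\<^sub>R F x)"
  proof
    fix x show "indicator K x *\<^sub>R F x = indicator U x *\<^sub>R F x"
      using assms(3) assms(4)[of x] by (cases "x \<in> K"; cases "x \<in> U") auto
  qed
  ultimately show ?thesis by (simp add: set_integrable_def)
qed

lemma partial_deriv_zero_on_diff: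
  assumes "open U" "compact K" "x \<in> U - K" "\<And>x. x \<in> U - K \<Longrightarrow> F x = 0"
  shows "partial_deriv i F x = 0"
proof -
  have "partial_deriv i F x = partial_deriv i (\<lambda>_. 0) x"
    using open_Diff[OF assms(1) compact_imp_closed[OF assms(2)]] assms(3,4)
    by (rule partial_deriv_cong)
  then show ?thesis by (simp add: partial_deriv_def)
qed

text \<open>The product, extended by 0 from \<open>U\<close>, is C^1 with compact support on the
  whole space, so its partial derivative integrates to 0. The factor \<open>a\<close> alone provides
  the compact support.\<close>

lemma integration_by_parts_partial:
  fixes a b :: "real^'n::finite \<Rightarrow> complex"
  assumes U: "open U" and K: "compact K" "K \<subseteq> U"
    and a: "Ck_on (Suc 0) U a" "\<And>x. x \<in> U - K \<Longrightarrow> a x = 0"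
    and b: "Ck_on (Suc 0) U b"
  shows "(LINT x:U|lborel. a x * partial_deriv i b x) = - (LINT x:U|lborel. partial_deriv i a x * b x)"
proof -
  let ?F = "\<lambda>x. if x \<in> U then a x * b x else 0"
  have da: "partial_deriv i a x = 0" if "x \<in> U - K" for x
    by (rule partial_deriv_zero_on_diff[OF U K(1) that a(2)])
  have "Ck_on (Suc 0) UNIV ?F"
    by (rule C1_on_extend_zero[OF U K C1_on_mult[OF a(1) b]]) (simp add: a(2))
  moreover have "?F x = 0" if "x \<notin> K" for x using a(2) that by simp
  ultimately have 0: "(\<integral>x. partial_deriv i ?F x \<partial>lborel) = 0"
    using integral_partial_deriv_eq_0 K(1) by blast
  have "partial_deriv i ?F x = indicator U x *\<^sub>R (a x * partial_deriv i b x + partial_deriv i a x * b x)" for x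
  proof (cases "x \<in> U")
    case True
    then have "partial_deriv i ?F x = partial_deriv i (\<lambda>x. a x * b x) x"
      by (intro partial_deriv_cong[OF U]) auto
    then show ?thesis
      using True partial_deriv_bilinear[OF bounded_bilinear_mult a(1) b True] by simp
  next
    case False
    then have "partial_deriv i ?F x = 0"
      by (intro partial_deriv_zero_outside[OF K(1)]) (use K a(2) in auto)
    then show ?thesis using False by simp
  qed
  then have "(LINT x:U|lborel. a x * partial_deriv i b x + partial_deriv i a x * b x) = 0"
    using 0 by (simp add: set_lebesgue_integral_def)
  moreover have "set_integrable lborel U (\<lambda>x. a x * partial_deriv i b x)"
    by (rule set_integrable_compact_support[OF _ K])
       (auto intro!: continuous_on_mult C1_on_continuous[OF a(1)] C1_on_continuous_partial[OF b] simp: a(2))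
  moreover have "set_integrable lborel U (\<lambda>x. partial_deriv i a x * b x)"
    by (rule set_integrable_compact_support[OF _ K])
       (auto intro!: continuous_on_mult C1_on_continuous_partial[OF a(1)] C1_on_continuous[OF b] simp: da)
  ultimately show ?thesis
    by (simp add: set_integral_add(2) eq_neg_iff_add_eq_0)
qed

text \<open>Two integrations by parts through the flux \<open>X\<close>. Regularity is asked of the
  fluxes because their partial derivatives are the only second-order terms in
  \<open>coord_laplacian\<close>. Compact support of \<open>u\<close> covers every product that
  occurs, since each contains \<open>u\<close>, a derivative of \<open>u\<close>, its flux or a
  derivative of its flux.\<close>

lemma coord_laplacian_symmetric:
  fixes u v :: "real^'n::finite \<Rightarrow> complex" and g :: "real^'n \<Rightarrow> real^'n^'n"
  defines "X \<equiv> \<lambda>u i x. coord_volume g x *\<^sub>R coord_grad g u x $ i"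
  assumes U: "open U" and K: "compact K" "K \<subseteq> U"
    and sym: "\<And>x i j. x \<in> U \<Longrightarrow> matrix_inv (g x) $ i $ j = matrix_inv (g x) $ j $ i"
    and vol: "\<And>x. x \<in> U \<Longrightarrow> coord_volume g x \<noteq> 0"
    and u: "Ck_on (Suc 0) U u" "\<And>i. Ck_on (Suc 0) U (X u i)" "\<And>x. x \<in> U - K \<Longrightarrow> u x = 0"
    and v: "Ck_on (Suc 0) U v" "\<And>i. Ck_on (Suc 0) U (X v i)"
  shows "(LINT x:U|lborel. coord_volume g x *\<^sub>R (u x * coord_laplacian g v x))
       = (LINT x:U|lborel. coord_volume g x *\<^sub>R (coord_laplacian g u x * v x))"
proof -
  have lap: "coord_volume g x *\<^sub>R coord_laplacian g w x = (\<Sum>i\<in>UNIV. partial_deriv i (X w i) x)" if "x \<in> U" for w x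
    using vol[OF that] by (simp add: coord_laplacian_def coord_div_def X_def)
  have lap_left: "coord_volume g x *\<^sub>R (w' x * coord_laplacian g w x) = (\<Sum>i\<in>UNIV. w' x * partial_deriv i (X w i) x)"
    and lap_right: "coord_volume g x *\<^sub>R (coord_laplacian g w x * w' x) = (\<Sum>i\<in>UNIV. partial_deriv i (X w i) x * w' x)"
    if "x \<in> U" for w w' x
    using lap[OF that, of w]
    by (metis mult_scaleR_right sum_distrib_left) (metis lap[OF that, of w] mult_scaleR_left sum_distrib_right)
  have du: "partial_deriv i u x = 0" if "x \<in> U - K" for x i
    by (rule partial_deriv_zero_on_diff[OF U K(1) that u(3)])
  have Xu: "X u i x = 0" if "x \<in> U - K" for x i
    using du[OF that] by (simp add: X_def coord_grad_def)
  have dXu: "partial_deriv i (X u i) x = 0" if "x \<in> U - K" for x i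
    by (rule partial_deriv_zero_on_diff[OF U K(1) that Xu])
  \<comment> \<open>Both sides are the volume density times the pairing of the two differentials by
    the inverse metric; its symmetry allows the exchange of \<open>u\<close> and
    \<open>v\<close>.\<close>
  have cross: "(\<Sum>i\<in>UNIV. partial_deriv i u x * X v i x) = (\<Sum>i\<in>UNIV. X u i x * partial_deriv i v x)"
    if "x \<in> U" for x
  proof -
    let ?A = "matrix_inv (g x)"
    have "(\<Sum>i\<in>UNIV. partial_deriv i u x * X v i x)
        = (\<Sum>i\<in>UNIV. \<Sum>j\<in>UNIV. (coord_volume g x * ?A $ i $ j) *\<^sub>R (partial_deriv i u x * partial_deriv j v x))"
      by (simp add: X_def coord_grad_def scaleR_sum_right sum_distrib_left)
    also have "\<dots> = (\<Sum>j\<in>UNIV. \<Sum>i\<in>UNIV. (coord_volume g x * ?A $ i $ j) *\<^sub>R (partial_deriv i u x * partial_deriv j v x))"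
      by (rule sum.swap)
    also have "\<dots> = (\<Sum>j\<in>UNIV. \<Sum>i\<in>UNIV. (coord_volume g x * ?A $ j $ i) *\<^sub>R (partial_deriv i u x * partial_deriv j v x))"
      using sym[OF that] by simp
    also have "\<dots> = (\<Sum>i\<in>UNIV. X u i x * partial_deriv i v x)"
      by (simp add: X_def coord_grad_def scaleR_sum_right sum_distrib_right)
    finally show ?thesis .
  qed
  have int: "set_integrable lborel U (\<lambda>x. a x * b x)"
    if "continuous_on U a" "continuous_on U b" "\<And>x. x \<in> U - K \<Longrightarrow> a x = 0" for a b :: "real^'n \<Rightarrow> complex"
    by (rule set_integrable_compact_support[OF _ K]) (use that in \<open>auto intro!: continuous_on_mult\<close>)
  note cont = C1_on_continuous C1_on_continuous_partial
  have sum: "(\<Sum>i\<in>UNIV. LINT x:U|lborel. f i x) = (LINT x:U|lborel. \<Sum>i\<in>UNIV. f i x)"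
    if "\<And>i. set_integrable lborel U (f i)" for f :: "'n \<Rightarrow> real^'n \<Rightarrow> complex"
    using that unfolding set_lebesgue_integral_def set_integrable_def scaleR_sum_right
    by (intro Bochner_Integration.integral_sum[symmetric])
  have "(LINT x:U|lborel. coord_volume g x *\<^sub>R (u x * coord_laplacian g v x))
      = (LINT x:U|lborel. \<Sum>i\<in>UNIV. u x * partial_deriv i (X v i) x)"
    by (rule set_lebesgue_integral_cong)
       (use U lap_left in auto)
  also have "\<dots> = (\<Sum>i\<in>UNIV. LINT x:U|lborel. u x * partial_deriv i (X v i) x)"
    by (rule sum[symmetric]) (intro int cont u v)
  also have "\<dots> = - (\<Sum>i\<in>UNIV. LINT x:U|lborel. partial_deriv i u x * X v i x)"
    using integration_by_parts_partial[OF U K u(1,3) v(2)] by (simp add: sum_negf)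
  also have "(\<Sum>i\<in>UNIV. LINT x:U|lborel. partial_deriv i u x * X v i x)
      = (LINT x:U|lborel. \<Sum>i\<in>UNIV. partial_deriv i u x * X v i x)"
    by (rule sum) (intro int cont u v du)
  also have "\<dots> = (LINT x:U|lborel. \<Sum>i\<in>UNIV. X u i x * partial_deriv i v x)"
    by (rule set_lebesgue_integral_cong) (use U cross in auto)
  also have "\<dots> = (\<Sum>i\<in>UNIV. LINT x:U|lborel. X u i x * partial_deriv i v x)"
    by (rule sum[symmetric]) (intro int cont u v Xu)
  also have "- \<dots> = (\<Sum>i\<in>UNIV. LINT x:U|lborel. partial_deriv i (X u i) x * v x)"
    using integration_by_parts_partial[OF U K u(2) Xu v(1)] by (simp add: sum_negf)
  also have "\<dots> = (LINT x:U|lborel. \<Sum>i\<in>UNIV. partial_deriv i (X u i) x * v x)"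
    by (rule sum) (intro int cont u v dXu)
  also have "\<dots> = (LINT x:U|lborel. coord_volume g x *\<^sub>R (coord_laplacian g u x * v x))"
    by (rule set_lebesgue_integral_cong)
       (use U lap_right in auto)
  finally show ?thesis .
qed

section \<open>The metric of a graph\<close>

lemma matrix_inv_unique:
  assumes "A ** B = mat 1" "B ** A = mat 1"
  shows "matrix_inv A = B"
proof -
  have "A ** matrix_inv A = mat 1 \<and> matrix_inv A ** A = mat 1"
    unfolding matrix_inv_def by (rule someI[of _ B]) (use assms in auto)
  then show ?thesis
    by (metis assms(2) matrix_mul_assoc matrix_mul_lid matrix_mul_rid)
qed

text \<open>The Sherman-Morrison formula for I + v v^T. The product of I + a v v^T and I + b v v^T
  has the same form with coefficient a + b + a b |v|^2, which vanishes for a = 1 and b = -1 / (1 +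
  |v|^2).\<close>

lemma matrix_inv_rank_one_update:
  fixes v :: "real^'n::finite"
  shows "matrix_inv (\<chi> i j. of_bool (i = j) + v $ i * v $ j)
       = (\<chi> i j. of_bool (i = j) - v $ i * v $ j / (1 + v \<bullet> v))" (is "matrix_inv ?A = ?B")
proof -
  have pos: "1 + v \<bullet> v \<noteq> 0" by (metis add_pos_nonneg inner_ge_zero less_numeral_extra(1) less_numeral_extra(3))
  have 1: "(\<Sum>k\<in>UNIV. (of_bool (i = k) + a * (v $ i * v $ k)) * (of_bool (k = j) + b * (v $ k * v $ j)))
      = of_bool (i = j) + (a + b + a * b * (v \<bullet> v)) * (v $ i * v $ j)" for i j a b
  proof -
    have "(\<Sum>k\<in>UNIV. (of_bool (i = k) + a * (v $ i * v $ k)) * (of_bool (k = j) + b * (v $ k * v $ j)))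
        = (\<Sum>k\<in>UNIV. (if k = i then of_bool (i = j) + b * (v $ i * v $ j) else 0)
             + ((if k = j then a * (v $ i * v $ j) else 0) + (a * b * (v $ i * v $ j)) * (v $ k * v $ k)))"
      by (rule sum.cong) (auto simp: algebra_simps)
    also have "\<dots> = of_bool (i = j) + b * (v $ i * v $ j) + (a * (v $ i * v $ j)
        + (a * b * (v $ i * v $ j)) * (v \<bullet> v))"
      by (simp add: sum.distrib sum_distrib_left[symmetric] inner_vec_def)
    finally show ?thesis by (simp add: algebra_simps)
  qed
  let ?b = "- 1 / (1 + v \<bullet> v)"
  have 2: "1 + ?b + 1 * ?b * (v \<bullet> v) = 0" "?b + 1 + ?b * 1 * (v \<bullet> v) = 0"
    using pos by (simp_all add: field_simps)
  show ?thesis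
  proof (rule matrix_inv_unique)
    show "?A ** ?B = mat 1"
      using 1[of _ 1 _ ?b] unfolding 2 by (simp add: matrix_matrix_mult_def mat_def vec_eq_iff)
    show "?B ** ?A = mat 1"
      using 1[of _ ?b _ 1] unfolding 2 by (simp add: matrix_matrix_mult_def mat_def vec_eq_iff)
  qed
qed

text \<open>An orthogonal matrix \<open>A\<close> that sends the basis vector of index
  \<open>k\<close> to v / |v| diagonalizes I + v v^T: the entry at \<open>k\<close> becomes 1 +
  |v|^2 and all others 1.\<close>

lemma det_rank_one_update:
  fixes v :: "real^'n::finite"
  shows "det (\<chi> i j. of_bool (i = j) + v $ i * v $ j) = 1 + v \<bullet> v" (is "det ?G = _")
proof (cases "v = 0")
  case True
  then have "?G = mat 1" by (simp add: mat_def vec_eq_iff)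
  then show ?thesis using True by simp
next
  case False
  fix k :: 'n
  have "norm (v /\<^sub>R norm v) = 1" using False by simp
  then obtain A where A: "orthogonal_matrix A" "A *v axis k 1 = v /\<^sub>R norm v"
    using orthogonal_matrix_exists_basis by metis
  have A_k: "A $ i $ k * norm v = v $ i" for i
  proof -
    have "A $ i $ k = (A *v axis k 1) $ i"
      by (simp add: matrix_vector_mul_component inner_axis)
    then show ?thesis using A(2) False by (simp add: field_simps)
  qed
  have AA: "A ** transpose A = mat 1" using A(1) by (simp add: orthogonal_matrix_def)
  define D :: "real^'n^'n" where "D = (\<chi> i j. of_bool (i = j) * (1 + of_bool (i = k) * (v \<bullet> v)))"
  have AD: "(A ** D) $ i $ l = A $ i $ l * (1 + of_bool (l = k) * (v \<bullet> v))" for i l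
  proof -
    have "(A ** D) $ i $ l = (\<Sum>m\<in>UNIV. A $ i $ m * D $ m $ l)"
      by (simp add: matrix_matrix_mult_def)
    also have "\<dots> = (\<Sum>m\<in>UNIV. if m = l then A $ i $ l * (1 + of_bool (l = k) * (v \<bullet> v)) else 0)"
      by (rule sum.cong) (auto simp: D_def)
    finally show ?thesis by simp
  qed
  have "(A ** D ** transpose A) $ i $ j = ?G $ i $ j" for i j
  proof -
    have "(A ** D ** transpose A) $ i $ j = (\<Sum>l\<in>UNIV. (A ** D) $ i $ l * A $ j $ l)"
      by (simp add: matrix_matrix_mult_def[of "A ** D"] transpose_def)
    also have "\<dots> = (\<Sum>l\<in>UNIV. A $ i $ l * A $ j $ l + (if l = k then (v \<bullet> v) * (A $ i $ k * A $ j $ k) else 0))"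
      by (rule sum.cong) (auto simp: AD algebra_simps)
    also have "\<dots> = (\<Sum>l\<in>UNIV. A $ i $ l * A $ j $ l) + (v \<bullet> v) * (A $ i $ k * A $ j $ k)"
      by (simp add: sum.distrib)
    also have "(\<Sum>l\<in>UNIV. A $ i $ l * A $ j $ l) = (A ** transpose A) $ i $ j"
      by (simp add: matrix_matrix_mult_def transpose_def)
    also have "(v \<bullet> v) * (A $ i $ k * A $ j $ k) = v $ i * v $ j"
      unfolding A_k[symmetric] by (simp add: dot_square_norm power2_eq_square)
    finally show ?thesis by (simp add: AA mat_def)
  qed
  then have "?G = A ** D ** transpose A" by (simp add: vec_eq_iff)
  then have "det ?G = det A * det D * det (transpose A)" by (simp add: det_mul)
  also have "\<dots> = det D * det (A ** transpose A)" by (simp add: det_mul)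
  also have "\<dots> = det D" by (simp add: AA)
  also have "\<dots> = (\<Prod>i\<in>UNIV. D $ i $ i)" by (rule det_diagonal) (simp add: D_def)
  also have "\<dots> = (\<Prod>i\<in>UNIV. if i = k then 1 + v \<bullet> v else 1)" by (rule prod.cong) (auto simp: D_def)
  also have "\<dots> = 1 + v \<bullet> v" by simp
  finally show ?thesis .
qed

section \<open>Metric, volume density and flux in terms of the Euclidean gradient\<close>

definition euclidean_grad :: "(real^'n::finite \<Rightarrow> real) \<Rightarrow> real^'n \<Rightarrow> real^'n" where
  "euclidean_grad f x = (\<chi> i. partial_deriv i f x)"

lemma has_derivative_euclidean_grad:
  assumes "f differentiable (at x)"
  shows "(f has_derivative (\<lambda>h. euclidean_grad f x \<bullet> h)) (at x)"
  using has_derivative_partials[OF assms]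
  by (simp add: euclidean_grad_def inner_vec_def mult.commute)

lemma euclidean_grad_eqI:
  assumes "(f has_derivative (\<lambda>h. a \<bullet> h)) (at x)"
  shows "euclidean_grad f x = a"
  by (simp add: euclidean_grad_def vec_eq_iff partial_deriv_eq[OF assms] inner_axis)

lemma has_derivative_graph_map:
  assumes "f differentiable (at x)"
  shows "(graph_map f has_derivative (\<lambda>h. (h, euclidean_grad f x \<bullet> h))) (at x)"
proof -
  have "((\<lambda>x. (x, f x)) has_derivative (\<lambda>h. (h, euclidean_grad f x \<bullet> h))) (at x)"
    by (intro has_derivative_Pair has_derivative_ident has_derivative_euclidean_grad assms)
  then show ?thesis by (simp add: graph_map_def[abs_def])
qed

lemma induced_metric_graph_map:
  fixes f :: "real^'n::finite \<Rightarrow> real"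
  assumes "f differentiable (at x)"
  shows "induced_metric (graph_map f) x
       = (\<chi> i j. of_bool (i = j) + euclidean_grad f x $ i * euclidean_grad f x $ j)"
proof -
  have "partial_deriv i (graph_map f) x = (axis i 1, euclidean_grad f x $ i)" for i
    by (simp add: partial_deriv_eq[OF has_derivative_graph_map[OF assms]] inner_axis)
  moreover have "axis i (1::real) \<bullet> axis j 1 = of_bool (i = j)" for i j :: 'n
    by (simp add: inner_axis_axis)
  ultimately show ?thesis by (simp add: induced_metric_def)
qed

definition area_element :: "(real^'n::finite \<Rightarrow> real) \<Rightarrow> real^'n \<Rightarrow> real" where
  "area_element f x = sqrt (1 + (norm (euclidean_grad f x))\<^sup>2)"

lemma area_element_ge_1: "area_element f x \<ge> 1"
  by (simp add: area_element_def)

lemma area_element_pos: "area_element f x > 0"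
  using area_element_ge_1[of f x] by linarith

lemma area_element_squared: "(area_element f x)\<^sup>2 = 1 + (norm (euclidean_grad f x))\<^sup>2"
  by (simp add: area_element_def)

lemma coord_volume_graph_map:
  "f differentiable (at x) \<Longrightarrow> coord_volume (induced_metric (graph_map f)) x = area_element f x"
  by (simp add: coord_volume_def induced_metric_graph_map det_rank_one_update area_element_def
      dot_square_norm)

lemma matrix_inv_induced_metric_graph_map:
  "f differentiable (at x) \<Longrightarrow> matrix_inv (induced_metric (graph_map f) x) $ i $ j
     = of_bool (i = j) - euclidean_grad f x $ i * euclidean_grad f x $ j / (area_element f x)\<^sup>2"
  by (simp add: induced_metric_graph_map matrix_inv_rank_one_update area_element_squared
      dot_square_norm)

text \<open>This is the flux that Green's formula asks to be C^1. Written through the Euclidean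
  gradients, it is visibly C^1 for a test function and can be evaluated for a radial
  \<open>u\<close>.\<close>

lemma weighted_coord_grad_graph_map:
  assumes "f differentiable (at x)"
  shows "coord_volume (induced_metric (graph_map f)) x *\<^sub>R coord_grad (induced_metric (graph_map f)) u x $ i
    = area_element f x *\<^sub>R partial_deriv i u x
      - (euclidean_grad f x $ i / area_element f x) *\<^sub>R (\<Sum>j\<in>UNIV. euclidean_grad f x $ j *\<^sub>R partial_deriv j u x)"
proof -
  let ?W = "area_element f x" and ?v = "euclidean_grad f x"
  have W: "?W \<noteq> 0" using area_element_pos[of f x] by linarith
  have coef: "?W * (of_bool (i = j) - ?v $ i * ?v $ j / ?W\<^sup>2) = (if j = i then ?W else 0) - ?v $ i / ?W * ?v $ j" for j
    using W by (simp add: field_simps power2_eq_square)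
  have "coord_volume (induced_metric (graph_map f)) x *\<^sub>R coord_grad (induced_metric (graph_map f)) u x $ i
    = (\<Sum>j\<in>UNIV. (?W * (of_bool (i = j) - ?v $ i * ?v $ j / ?W\<^sup>2)) *\<^sub>R partial_deriv j u x)"
    using assms by (simp add: coord_grad_def coord_volume_graph_map matrix_inv_induced_metric_graph_map
        scaleR_sum_right)
  also have "\<dots> = (\<Sum>j\<in>UNIV. (if j = i then ?W *\<^sub>R partial_deriv i u x else 0)
      - (?v $ i / ?W) *\<^sub>R (?v $ j *\<^sub>R partial_deriv j u x))"
    unfolding coef by (rule sum.cong) (auto simp: scaleR_diff_left)
  finally show ?thesis by (simp add: sum_subtractf scaleR_sum_right)
qed

section \<open>Radial graphs\<close>

text \<open>\<open>domain_radial\<close> treats balls around the origin and the whole space alike;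
  the two cases separate only when windows are selected.\<close>

locale radial_graph =
  fixes D :: "(real^'n::finite) set" and f :: "real^'n \<Rightarrow> real"
  assumes open_domain: "open D" and zero_in_domain: "0 \<in> D"
    and domain_radial: "\<And>x y. x \<in> D \<Longrightarrow> norm y \<le> norm x \<Longrightarrow> y \<in> D"
    and smooth: "smooth_on D f" and radial: "radial_on D f"
begin

text \<open>An arbitrary coordinate axis, on which the profile of the radial function is read off.\<close>

definition direction :: 'n where "direction = undefined"

definition ray :: "real \<Rightarrow> real^'n" where "ray t = t *\<^sub>R axis direction 1"

text \<open>Negative \<open>t\<close> are included: the set is symmetric and open, so the profile
  has two-sided derivatives at radius 0 as well.\<close>

definition radii :: "real set" where "radii = {t. ray t \<in> D}"

text \<open>The profile derivative f'. Reading it off a partial derivative along an axis transfers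
  the regularity of \<open>f\<close> to it.\<close>

definition slope :: "real \<Rightarrow> real" where "slope t = partial_deriv direction f (ray t)"

definition slope' :: "real \<Rightarrow> real" where
  "slope' t = partial_deriv direction (partial_deriv direction f) (ray t)"

definition speed :: "real \<Rightarrow> real" where "speed t = sqrt (1 + (slope t)\<^sup>2)"

definition arc_length :: "real \<Rightarrow> real" where "arc_length t = integral {0..t} speed"

lemma norm_ray [simp]: "norm (ray t) = \<bar>t\<bar>"
  by (simp add: ray_def)

lemma norm_in_radii_iff: "norm x \<in> radii \<longleftrightarrow> x \<in> D"
  using domain_radial[of x "ray (norm x)"] domain_radial[of "ray (norm x)" x] by (auto simp: radii_def)

lemma radii_downward: "t \<in> radii \<Longrightarrow> \<bar>s\<bar> \<le> \<bar>t\<bar> \<Longrightarrow> s \<in> radii"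
  using domain_radial[of "ray t" "ray s"] by (simp add: radii_def)

lemma continuous_ray: "continuous_on S ray"
  unfolding ray_def[abs_def] by (intro continuous_intros)

lemma open_radii: "open radii"
proof -
  have "radii = ray -` D" by (auto simp: radii_def)
  then show ?thesis using open_vimage[OF open_domain continuous_ray] by simp
qed

lemma Ck: "Ck_on k D f"
  using smooth by (simp add: smooth_on_def)

lemma C1: "Ck_on (Suc 0) D f" and C1_partial: "Ck_on (Suc 0) D (partial_deriv i f)"
  using Ck[of "Suc 0"] Ck[of "Suc (Suc 0)"] by simp_all

lemma differentiable: "x \<in> D \<Longrightarrow> f differentiable (at x)"
  by (rule C1_on_differentiable[OF C1])

lemma C1_euclidean_grad: "Ck_on (Suc 0) D (\<lambda>x. euclidean_grad f x $ i)"
  unfolding euclidean_grad_def vec_lambda_beta by (rule C1_partial)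

lemma has_vector_derivative_along_ray:
  assumes "Ck_on (Suc 0) D u" "t \<in> radii"
  shows "((\<lambda>t. u (ray t)) has_vector_derivative partial_deriv direction u (ray t)) (at t)"
proof -
  have "(ray has_derivative (\<lambda>h. h *\<^sub>R axis direction 1)) (at t)"
    unfolding ray_def[abs_def] by (auto intro!: derivative_eq_intros)
  from has_derivative_compose[OF this C1_on_has_derivative[OF assms(1)]] assms(2)
  have "((\<lambda>t. u (ray t)) has_derivative
     (\<lambda>h. \<Sum>j\<in>UNIV. (h *\<^sub>R axis direction (1::real)) $ j *\<^sub>R partial_deriv j u (ray t))) (at t)"
    by (simp add: radii_def)
  moreover have "(\<Sum>j\<in>UNIV. (h *\<^sub>R axis direction (1::real)) $ j *\<^sub>R partial_deriv j u y)
      = h *\<^sub>R partial_deriv direction u y" for h y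
  proof -
    have "(\<Sum>j\<in>UNIV. (h *\<^sub>R axis direction (1::real)) $ j *\<^sub>R partial_deriv j u y)
       = h *\<^sub>R (\<Sum>j\<in>UNIV. axis direction (1::real) $ j *\<^sub>R partial_deriv j u y)"
      by (simp add: scaleR_sum_right)
    then show ?thesis by (simp only: sum_axis_scaleR)
  qed
  ultimately show ?thesis by (simp add: has_vector_derivative_def)
qed

lemma slope_has_derivative: "t \<in> radii \<Longrightarrow> (slope has_real_derivative slope' t) (at t)"
  using has_vector_derivative_along_ray[OF C1_partial[of direction]]
  by (simp add: slope_def[abs_def] slope'_def has_real_derivative_iff_has_vector_derivative)

lemma continuous_slope': "continuous_on radii slope'"
  unfolding slope'_def[abs_def]
  by (rule continuous_on_compose2[OF C1_on_continuous_partial[OF C1_partial] continuous_ray])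
     (auto simp: radii_def)

lemma continuous_slope: "continuous_on radii slope"
  by (rule DERIV_continuous_on, rule has_field_derivative_at_within, rule slope_has_derivative)

lemma continuous_speed: "continuous_on radii speed"
  unfolding speed_def[abs_def] by (intro continuous_intros continuous_slope)

lemma speed_ge_1: "speed t \<ge> 1"
  by (simp add: speed_def)

section \<open>Gradient, Hessian and Christoffel symbols away from the origin\<close>

lemma has_derivative_norm_nonzero:
  "x \<noteq> 0 \<Longrightarrow> (norm has_derivative (\<lambda>h. (x \<bullet> h) / norm x)) (at (x :: real^'n))"
  using has_derivative_norm[of x] by (simp add: sgn_div_norm inner_commute divide_inverse mult.commute)

text \<open>Near \<open>x\<close> the function is \<open>f (ray (norm y))\<close>, to which the
  chain rule applies because the norm is differentiable at \<open>x\<close>.\<close>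

lemma euclidean_grad_radial:
  assumes "x \<in> D" "x \<noteq> 0"
  shows "euclidean_grad f x = (slope (norm x) / norm x) *\<^sub>R x"
proof (rule euclidean_grad_eqI)
  have r: "ray (norm x) \<in> D" using assms(1) norm_in_radii_iff[of x] by (simp add: radii_def)
  have "((\<lambda>y. ray (norm y)) has_derivative (\<lambda>h. ((x \<bullet> h) / norm x) *\<^sub>R axis direction 1)) (at x)"
    unfolding ray_def
    by (rule has_derivative_scaleR_left[OF has_derivative_norm_nonzero[OF assms(2)]])
  from has_derivative_compose[OF this has_derivative_euclidean_grad[OF differentiable[OF r]]]
  have "((\<lambda>y. f (ray (norm y))) has_derivative (\<lambda>h. ((slope (norm x) / norm x) *\<^sub>R x) \<bullet> h)) (at x)"
    by (simp add: euclidean_grad_def slope_def inner_axis algebra_simps)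
  then show "(f has_derivative (\<lambda>h. ((slope (norm x) / norm x) *\<^sub>R x) \<bullet> h)) (at x)"
  proof (rule has_derivative_transform_within_open[OF _ open_domain assms(1)])
    fix y assume y: "y \<in> D"
    then have "ray (norm y) \<in> D" using norm_in_radii_iff[of y] by (simp add: radii_def)
    then show "f (ray (norm y)) = f y"
      by (intro radial[unfolded radial_on_def, rule_format] y) simp_all
  qed
qed

lemma area_element_radial:
  assumes "x \<in> D" "x \<noteq> 0"
  shows "area_element f x = speed (norm x)"
  using assms by (simp add: area_element_def euclidean_grad_radial speed_def)

lemma partial_deriv_norm:
  "x \<noteq> 0 \<Longrightarrow> partial_deriv i norm (x :: real^'n) = x $ i / norm x"
  by (simp add: partial_deriv_eq[OF has_derivative_norm_nonzero] inner_axis)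

lemma C1_norm: "Ck_on (Suc 0) (- {0}) (norm :: real^'n \<Rightarrow> real)"
  by (rule C1_onI[OF has_derivative_norm_nonzero]) (auto simp: inner_axis intro!: continuous_intros)

lemma C1_component: "Ck_on (Suc 0) U (\<lambda>x :: real^'n. x $ i)"
  and partial_deriv_component: "partial_deriv j (\<lambda>x :: real^'n. x $ i) x = of_bool (i = j)"
proof -
  have D: "((\<lambda>x :: real^'n. x $ i) has_derivative (\<lambda>h. h $ i)) (at x)" for x
    by (rule bounded_linear_imp_has_derivative[OF bounded_linear_vec_nth])
  show "Ck_on (Suc 0) U (\<lambda>x :: real^'n. x $ i)" by (rule C1_onI[OF D]) simp
  show "partial_deriv j (\<lambda>x :: real^'n. x $ i) x = of_bool (i = j)"
    by (simp add: partial_deriv_eq[OF D] axis_def)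
qed

lemma open_punctured: "open (D - {0})"
  using open_domain by (rule open_delete)

text \<open>Obtained from the radial form rather than from a theorem on mixed partials: with q(r) =
  f'(r) / r the entries are \<delta>_ij q(r) + q'(r) x_i x_j / r, which is symmetric at
  sight.\<close>

lemma hessian_symmetric:
  assumes "x \<in> D" "x \<noteq> 0"
  shows "partial_deriv j (\<lambda>y. euclidean_grad f y $ i) x = partial_deriv i (\<lambda>y. euclidean_grad f y $ j) x"
proof -
  let ?q = "\<lambda>t. slope t / t" and ?q' = "\<lambda>t. (slope' t * t - slope t) / t\<^sup>2"
  let ?T = "radii - {0}"
  have q: "(?q has_vector_derivative ?q' t) (at t)" if "t \<in> ?T" for t
    using slope_has_derivative[of t] that
    unfolding has_real_derivative_iff_has_vector_derivative[symmetric]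
    by (auto intro!: derivative_eq_intros simp: power2_eq_square)
  have q': "continuous_on ?T ?q'"
    by (intro continuous_intros continuous_on_subset[OF continuous_slope']
        continuous_on_subset[OF continuous_slope]) auto
  have n: "Ck_on (Suc 0) (D - {0}) (norm :: real^'n \<Rightarrow> real)"
    by (rule C1_on_subset[OF C1_norm]) auto
  have mem: "y \<in> D - {0} \<Longrightarrow> norm y \<in> ?T" for y using norm_in_radii_iff[of y] by auto
  note comp = C1_on_compose[OF n mem q q']
  have x: "x \<in> D - {0}" using assms by auto
  have "partial_deriv j (\<lambda>y. euclidean_grad f y $ i) x
      = of_bool (i = j) * ?q (norm x) + ?q' (norm x) / norm x * (x $ i * x $ j)" for i j
  proof -
    have "partial_deriv j (\<lambda>y. euclidean_grad f y $ i) x = partial_deriv j (\<lambda>y. ?q (norm y) * y $ i) x"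
      by (rule partial_deriv_cong[OF open_punctured x]) (simp add: euclidean_grad_radial)
    also have "\<dots> = ?q (norm x) * partial_deriv j (\<lambda>y. y $ i) x + partial_deriv j (\<lambda>y. ?q (norm y)) x * x $ i"
      by (rule partial_deriv_bilinear[OF bounded_bilinear_mult comp(1) C1_component x])
    also have "partial_deriv j (\<lambda>y. ?q (norm y)) x = x $ j / norm x * ?q' (norm x)"
      using comp(2)[OF _ _ x] assms(2) by (simp add: partial_deriv_norm)
    finally show ?thesis by (simp add: partial_deriv_component mult_ac)
  qed
  then show ?thesis by (simp add: mult.commute eq_commute)
qed

text \<open>The metric is I plus the square of the gradient, so the bracket in the definition
  collapses to twice a Hessian entry times a gradient component, and the inverse metric maps the
  gradient G to G / W^2.\<close>

lemma christoffel_graph: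
  assumes "x \<in> D" "x \<noteq> 0"
  shows "christoffel (induced_metric (graph_map f)) k i j x
       = euclidean_grad f x $ k * partial_deriv i (\<lambda>y. euclidean_grad f y $ j) x / (area_element f x)\<^sup>2"
proof -
  let ?G = "\<lambda>i y. euclidean_grad f y $ i" and ?g = "induced_metric (graph_map f)"
  let ?W = "area_element f x"
  have dg: "partial_deriv l (\<lambda>y. ?g y $ i $ j) x
      = ?G i x * partial_deriv l (?G j) x + partial_deriv l (?G i) x * ?G j x" for l i j
  proof -
    have c: "Ck_on (Suc 0) D (\<lambda>y. ?G i y * ?G j y)"
      by (intro C1_on_mult C1_euclidean_grad)
    have "partial_deriv l (\<lambda>y. ?g y $ i $ j) x = partial_deriv l (\<lambda>y. of_bool (i = j) + ?G i y * ?G j y) x"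
      by (rule partial_deriv_cong[OF open_domain assms(1)])
         (simp add: induced_metric_graph_map differentiable)
    also have "\<dots> = partial_deriv l (\<lambda>y. ?G i y * ?G j y) x"
    proof -
      have "((\<lambda>y. of_bool (i = j) + ?G i y * ?G j y) has_derivative
          (\<lambda>h. 0 + (\<Sum>m\<in>UNIV. h $ m *\<^sub>R partial_deriv m (\<lambda>y. ?G i y * ?G j y) x))) (at x)"
        by (intro has_derivative_add has_derivative_const C1_on_has_derivative[OF c assms(1)])
      from partial_deriv_eq[OF this] show ?thesis by (simp only: sum_axis_scaleR add_0_left)
    qed
    also have "\<dots> = ?G i x * partial_deriv l (?G j) x + partial_deriv l (?G i) x * ?G j x"
      by (rule partial_deriv_bilinear[OF bounded_bilinear_mult C1_euclidean_grad C1_euclidean_grad assms(1)])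
    finally show ?thesis .
  qed
  have W: "?W\<^sup>2 = 1 + euclidean_grad f x \<bullet> euclidean_grad f x"
    by (simp add: area_element_squared dot_square_norm)
  moreover have "?W\<^sup>2 \<noteq> 0"
    using area_element_pos[of f x] by simp
  ultimately have "1 + euclidean_grad f x \<bullet> euclidean_grad f x \<noteq> 0" by simp
  note W = W this
  \<comment> \<open>By symmetry of the Hessian four of the six terms cancel in pairs and the two
    others coincide.\<close>
  have br: "partial_deriv i (\<lambda>y. ?g y $ j $ l) x + partial_deriv j (\<lambda>y. ?g y $ i $ l) x
          - partial_deriv l (\<lambda>y. ?g y $ i $ j) x = 2 * (partial_deriv i (?G j) x * ?G l x)" for l
    unfolding dg using hessian_symmetric[OF assms] by (simp add: algebra_simps)
  have "(\<Sum>l\<in>UNIV. matrix_inv (?g x) $ k $ l * ?G l x) = ?G k x / ?W\<^sup>2"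
  proof -
    have "(\<Sum>l\<in>UNIV. matrix_inv (?g x) $ k $ l * ?G l x)
       = (\<Sum>l\<in>UNIV. (if l = k then ?G k x else 0) - ?G k x / ?W\<^sup>2 * (?G l x * ?G l x))"
      by (rule sum.cong) (auto simp: matrix_inv_induced_metric_graph_map differentiable[OF assms(1)] algebra_simps)
    also have "\<dots> = ?G k x - ?G k x / ?W\<^sup>2 * (euclidean_grad f x \<bullet> euclidean_grad f x)"
      by (simp only: sum_subtractf sum_distrib_left[symmetric]) (simp add: inner_vec_def)
    finally show ?thesis using W by (simp add: field_simps)
  qed
  moreover have "christoffel ?g k i j x
     = partial_deriv i (?G j) x * (\<Sum>l\<in>UNIV. matrix_inv (?g x) $ k $ l * ?G l x)"
    unfolding christoffel_def br by (simp add: sum_distrib_left sum_divide_distrib mult_ac)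
  ultimately show ?thesis by simp
qed

end

section \<open>Completeness and arc length\<close>

lemma constant_on_interval:
  fixes f :: "real \<Rightarrow> real"
  assumes "\<And>t. 0 \<le> t \<Longrightarrow> t \<le> b \<Longrightarrow> (f has_real_derivative 0) (at t)" "0 \<le> t" "t \<le> b"
  shows "f t = f 0"
proof (cases "b = 0")
  case False
  have "continuous_on {0..b} f"
    by (rule DERIV_continuous_on, rule has_field_derivative_at_within, rule assms(1)) auto
  then show ?thesis using False assms by (intro DERIV_isconst2[of 0 b]) auto
qed (use assms in simp)

lemma inner_has_real_derivative:
  fixes a b :: "real \<Rightarrow> 'a::real_inner"
  assumes "(a has_vector_derivative a') (at t)" "(b has_vector_derivative b') (at t)"
  shows "((\<lambda>t. a t \<bullet> b t) has_real_derivative a t \<bullet> b' + a' \<bullet> b t) (at t)"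
  using bounded_bilinear.has_vector_derivative[OF bounded_bilinear_inner assms]
  by (simp add: has_real_derivative_iff_has_vector_derivative)

text \<open>The zeros in \<open>{0..t}\<close> form a nonempty compact set, so there is a least one;
  a nonpositive value before it would produce an earlier zero. It yields the first time at which a
  geodesic could stop moving outward.\<close>

lemma first_zero:
  fixes P :: "real \<Rightarrow> real"
  assumes "continuous_on UNIV P" "P 0 > 0" "0 \<le> t" "P t \<le> 0"
  obtains s where "0 < s" "P s = 0" "\<And>r. 0 \<le> r \<Longrightarrow> r < s \<Longrightarrow> P r > 0"
proof -
  let ?Z = "{r \<in> {0..t}. P r = 0}"
  have cont: "continuous_on {a..b} P" for a b using assms(1) by (rule continuous_on_subset) simp
  have zero: "\<exists>s\<in>{0..r}. P s = 0" if "0 \<le> r" "P r \<le> 0" for r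
    using IVT2'[of P r 0 0] that assms(2) cont by auto
  have "closed ?Z"
    by (rule continuous_closed_preimage_constant[OF cont]) simp
  moreover have "bounded ?Z" by (rule bounded_subset[of "{0..t}"]) auto
  ultimately have "compact ?Z" by (simp add: compact_eq_bounded_closed)
  moreover have "?Z \<noteq> {}" using zero[OF assms(3,4)] by auto
  ultimately have "\<exists>s\<in>?Z. \<forall>r\<in>?Z. s \<le> r" by (rule compact_attains_inf)
  then obtain s where s: "s \<in> ?Z" "\<And>r. r \<in> ?Z \<Longrightarrow> s \<le> r" by blast
  show ?thesis
  proof (rule that[of s])
    show "0 < s" using s(1) assms(2) by (cases "s = 0") auto
    show "P s = 0" using s(1) by simp
    show "P r > 0" if r: "0 \<le> r" "r < s" for r
    proof (rule ccontr)
      assume "\<not> P r > 0"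
      then obtain q where "q \<in> {0..r}" "P q = 0" using zero[of r] r by auto
      then show False using s(2)[of q] s(1) r by auto
    qed
  qed
qed

context radial_graph
begin

lemma radii_interval: "b \<in> radii \<Longrightarrow> {0..b} \<subseteq> radii"
  using radii_downward[of b] by auto

text \<open>Radius 0 is excluded because \<open>arc_length\<close> is constantly 0 on the negative
  numbers, so that at 0 only the right derivative equals \<open>speed\<close>.\<close>

lemma arc_length_has_derivative:
  assumes "t \<in> radii" "0 < t"
  shows "(arc_length has_real_derivative speed t) (at t)"
proof -
  obtain e where e: "e > 0" "ball t e \<subseteq> radii"
    using open_radii assms(1) open_contains_ball by blast
  define b where "b = t + e / 2"
  have b: "t < b" "b \<in> radii" using e by (auto simp: b_def dist_real_def intro!: subsetD[OF e(2)])
  have "((\<lambda>u. integral {0..u} speed) has_vector_derivative speed t) (at t within {0..b})"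
    by (rule integral_has_vector_derivative)
       (use assms b radii_interval[OF b(2)] in \<open>auto intro: continuous_on_subset[OF continuous_speed]\<close>)
  moreover have "at t within {0..b} = at t"
    by (rule at_within_interior) (use assms b in auto)
  ultimately show ?thesis
    by (simp add: arc_length_def[abs_def] has_real_derivative_iff_has_vector_derivative)
qed

text \<open>It has to be excluded that \<open>c\<close> turns back or meets the origin. Both follow
  once \<open>P\<close>, half the derivative of |c|^2, stays positive. The two conserved quantities
  then give sqrt(E 0) |c| = P w, which says that arc length grows at the constant rate
  \<open>sqrt (E 0)\<close>.\<close>

lemma arc_length_along_radial_geodesic:
  assumes c_in: "\<And>t. c t \<in> D"
    and c': "\<And>t. (c has_vector_derivative v t) (at t)"
    and v': "\<And>t. (v has_vector_derivative (\<chi> k. - (\<Sum>i\<in>UNIV. \<Sum>j\<in>UNIV.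
        christoffel (induced_metric (graph_map f)) k i j (c t) * v t $ i * v t $ j))) (at t)"
    and init: "c 0 = x" "v 0 = x" "x \<noteq> 0"
  obtains a where "a > 0" "\<And>t. 0 \<le> t \<Longrightarrow> c t \<noteq> 0"
    "\<And>t. 0 \<le> t \<Longrightarrow> arc_length (norm (c t)) = arc_length (norm x) + a * t"
proof -
  define G where "G j t = euclidean_grad f (c t) $ j" for j t
  define H where "H i j t = partial_deriv i (\<lambda>y. euclidean_grad f y $ j) (c t)" for i j t
  \<comment> \<open>The Hessian of \<open>f\<close> at the velocity, divided by W^2: the geodesic
    equation becomes v' = -\<kappa> grad f, an acceleration parallel to \<open>c\<close>.\<close>
  define \<kappa> where "\<kappa> t = (\<Sum>i\<in>UNIV. \<Sum>j\<in>UNIV. H i j t * v t $ i * v t $ j) / (area_element f (c t))\<^sup>2" for t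
  define P where "P t = c t \<bullet> v t" for t
  define Q where "Q t = (v t \<bullet> v t) * (c t \<bullet> c t) - (P t)\<^sup>2" for t
  \<comment> \<open>The derivative of \<open>f\<close> along \<open>c\<close>, that is, the last
    coordinate of the velocity in the ambient space; hence \<open>E\<close> is the squared speed on
    the graph.\<close>
  define B where "B t = (\<Sum>j\<in>UNIV. G j t * v t $ j)" for t
  define E where "E t = v t \<bullet> v t + (B t)\<^sup>2" for t
  txt \<open>\<open>Q\<close> (angular momentum squared) and \<open>E\<close> (energy) are conserved; \<open>Q = 0\<close> keeps \<open>c\<close> and \<open>v\<close> parallel.
    The conservation laws are only used where \<open>c\<close> is nonzero, because the Christoffel symbols are
    computed away from the origin.\<close>
  define \<mu> where "\<mu> t = slope (norm (c t)) / norm (c t)" for t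
  have acc: "(v has_vector_derivative - \<kappa> t *\<^sub>R euclidean_grad f (c t)) (at t)" if "c t \<noteq> 0" for t
  proof -
    have "(\<Sum>i\<in>UNIV. \<Sum>j\<in>UNIV. christoffel (induced_metric (graph_map f)) k i j (c t) * v t $ i * v t $ j)
        = \<kappa> t * euclidean_grad f (c t) $ k" for k
      unfolding christoffel_graph[OF c_in that] \<kappa>_def H_def sum_divide_distrib sum_distrib_right
      by (intro sum.cong refl) (simp add: mult_ac)
    then have "(\<chi> k. - (\<Sum>i\<in>UNIV. \<Sum>j\<in>UNIV.
        christoffel (induced_metric (graph_map f)) k i j (c t) * v t $ i * v t $ j))
        = - \<kappa> t *\<^sub>R euclidean_grad f (c t)" by (simp add: vec_eq_iff)
    then show ?thesis using v'[of t] by simp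
  qed
  have grad: "euclidean_grad f (c t) = \<mu> t *\<^sub>R c t" if "c t \<noteq> 0" for t
    unfolding \<mu>_def by (rule euclidean_grad_radial[OF c_in that])
  have acc': "(v has_vector_derivative - (\<kappa> t * \<mu> t) *\<^sub>R c t) (at t)" if "c t \<noteq> 0" for t
    using acc[OF that] by (simp add: grad[OF that])
  have dc: "((\<lambda>t. c t \<bullet> c t) has_real_derivative 2 * P t) (at t)" for t
    using inner_has_real_derivative[OF c' c'] by (simp add: P_def inner_commute)
  have dv: "((\<lambda>t. v t \<bullet> v t) has_real_derivative - (2 * \<kappa> t * \<mu> t * P t)) (at t)" if "c t \<noteq> 0" for t
    using inner_has_real_derivative[OF acc'[OF that] acc'[OF that]] by (simp add: P_def inner_commute algebra_simps)
  have dP: "(P has_real_derivative v t \<bullet> v t - \<kappa> t * \<mu> t * (c t \<bullet> c t)) (at t)" if "c t \<noteq> 0" for t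
    unfolding P_def[abs_def]
    using inner_has_real_derivative[OF c' acc'[OF that]] by (simp add: algebra_simps)
  have dQ: "(Q has_real_derivative 0) (at t)" if "c t \<noteq> 0" for t
  proof -
    have "(Q has_real_derivative (v t \<bullet> v t) * (2 * P t) + (- (2 * \<kappa> t * \<mu> t * P t)) * (c t \<bullet> c t)
        - 2 * P t * (v t \<bullet> v t - \<kappa> t * \<mu> t * (c t \<bullet> c t))) (at t)"
      unfolding Q_def[abs_def] by (auto intro!: derivative_eq_intros dv[OF that] dc dP[OF that])
    then show ?thesis by (simp add: algebra_simps)
  qed
  have dG: "(G j has_real_derivative (\<Sum>i\<in>UNIV. v t $ i * H i j t)) (at t)" for j t
  proof -
    have "((\<lambda>t. euclidean_grad f (c t) $ j) has_derivative
        (\<lambda>h. \<Sum>i\<in>UNIV. (h *\<^sub>R v t) $ i *\<^sub>R H i j t)) (at t)"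
      unfolding H_def
      by (rule has_derivative_compose[OF c'[unfolded has_vector_derivative_def]
            C1_on_has_derivative[OF C1_euclidean_grad c_in]])
    moreover have "(\<lambda>h. \<Sum>i\<in>UNIV. (h *\<^sub>R v t) $ i *\<^sub>R H i j t) = (\<lambda>h. h * (\<Sum>i\<in>UNIV. v t $ i * H i j t))"
      by (simp add: sum_distrib_left mult_ac)
    ultimately show ?thesis
      by (simp add: G_def[abs_def] has_field_derivative_def mult_commute_abs)
  qed
  \<comment> \<open>The Hessian contributes \<kappa> W^2 and the acceleration -\<kappa> |grad f|^2;
    their sum is \<kappa> because W^2 = 1 + |grad f|^2.\<close>
  have dB: "(B has_real_derivative \<kappa> t) (at t)" if "c t \<noteq> 0" for t
  proof -
    let ?g = "euclidean_grad f (c t)" and ?W = "area_element f (c t)"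
    have dvj: "((\<lambda>t. v t $ j) has_real_derivative - \<kappa> t * G j t) (at t)" for j
      using bounded_linear.has_vector_derivative[OF bounded_linear_vec_nth acc[OF that], of j]
      by (simp add: has_real_derivative_iff_has_vector_derivative G_def)
    have "(B has_real_derivative (\<Sum>j\<in>UNIV. (\<Sum>i\<in>UNIV. v t $ i * H i j t) * v t $ j + (- \<kappa> t * G j t) * G j t)) (at t)"
      unfolding B_def[abs_def] by (intro DERIV_sum DERIV_mult dG dvj)
    moreover have "(\<Sum>j\<in>UNIV. (\<Sum>i\<in>UNIV. v t $ i * H i j t) * v t $ j + (- \<kappa> t * G j t) * G j t) = \<kappa> t"
    proof -
      have "(\<Sum>j\<in>UNIV. (\<Sum>i\<in>UNIV. v t $ i * H i j t) * v t $ j) = (\<Sum>j\<in>UNIV. \<Sum>i\<in>UNIV. H i j t * v t $ i * v t $ j)"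
        unfolding sum_distrib_right by (intro sum.cong refl) (simp add: mult_ac)
      also have "\<dots> = (\<Sum>i\<in>UNIV. \<Sum>j\<in>UNIV. H i j t * v t $ i * v t $ j)" by (rule sum.swap)
      also have "\<dots> = \<kappa> t * ?W\<^sup>2"
        using area_element_pos[of f "c t"] by (simp add: \<kappa>_def)
      finally have 1: "(\<Sum>j\<in>UNIV. (\<Sum>i\<in>UNIV. v t $ i * H i j t) * v t $ j) = \<kappa> t * ?W\<^sup>2" .
      have 2: "(\<Sum>j\<in>UNIV. (- \<kappa> t * G j t) * G j t) = - \<kappa> t * (norm ?g)\<^sup>2"
        by (simp add: G_def sum_negf sum_distrib_left power2_norm_eq_inner inner_vec_def mult_ac)
      show ?thesis
        unfolding sum.distrib 1 2 area_element_squared by (simp add: algebra_simps)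
    qed
    ultimately show ?thesis by simp
  qed
  have B_eq: "B t = \<mu> t * P t" if "c t \<noteq> 0" for t
  proof -
    have "B t = euclidean_grad f (c t) \<bullet> v t" by (simp add: B_def G_def inner_vec_def)
    then show ?thesis by (simp add: grad[OF that] P_def)
  qed
  have dE: "(E has_real_derivative 0) (at t)" if "c t \<noteq> 0" for t
  proof -
    have "(E has_real_derivative - (2 * \<kappa> t * \<mu> t * P t) + 2 * B t * \<kappa> t) (at t)"
      unfolding E_def[abs_def] by (auto intro!: derivative_eq_intros dv[OF that] dB[OF that])
    then show ?thesis by (simp add: B_eq[OF that] algebra_simps)
  qed
  have Q0: "Q 0 = 0" by (simp add: Q_def P_def init power2_eq_square)
  have E0: "E 0 > 0" using init by (simp add: E_def add_pos_nonneg)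
  have contP: "continuous_on UNIV P"
    unfolding P_def[abs_def] by (intro continuous_on_inner)
      (auto intro!: has_vector_derivative_continuous continuous_at_imp_continuous_on
        intro: c' v')
  \<comment> \<open>At a first zero \<open>s\<close> of \<open>P\<close> the norm of
    \<open>c\<close> has not decreased, so the origin is avoided up to \<open>s\<close> and the
    conservation laws hold. Then \<open>Q s = 0\<close> and \<open>P s = 0\<close> force the
    velocity to vanish, hence \<open>E s = 0\<close>, against \<open>E 0 > 0\<close>.\<close>
  have P_pos: "P t > 0" if t: "0 \<le> t" for t
  proof (rule ccontr)
    assume "\<not> P t > 0"
    then have "P t \<le> 0" by simp
    moreover have "P 0 > 0" using init by (simp add: P_def)
    ultimately obtain s where s: "0 < s" "P s = 0" "\<And>r. 0 \<le> r \<Longrightarrow> r < s \<Longrightarrow> P r > 0"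
      using first_zero[OF contP _ t] by blast
    have P_nonneg: "P r \<ge> 0" if "0 \<le> r" "r \<le> s" for r
      using s(2) s(3)[of r] that by (cases "r = s") auto
    have nz: "c r \<noteq> 0" if "0 \<le> r" "r \<le> s" for r
    proof -
      have "c 0 \<bullet> c 0 \<le> c r \<bullet> c r"
      proof (rule DERIV_nonneg_imp_nondecreasing[OF that(1)])
        fix q assume "0 \<le> q" "q \<le> r"
        then have "0 \<le> 2 * P q" using P_nonneg[of q] that by simp
        then show "\<exists>y. ((\<lambda>t. c t \<bullet> c t) has_real_derivative y) (at q) \<and> 0 \<le> y"
          using dc by blast
      qed
      moreover have "0 < c 0 \<bullet> c 0" using init by simp
      ultimately show ?thesis by force
    qed
    have "Q s = 0"
      using constant_on_interval[of s Q s] dQ nz s(1) Q0 by simp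
    then have "v s \<bullet> v s = 0" using s nz[of s] by (simp add: Q_def)
    then have "E s = 0" using B_eq[OF nz[of s]] s by (simp add: E_def)
    moreover have "E s = E 0" using constant_on_interval[of s E s] dE nz s(1) by simp
    ultimately show False using E0 by simp
  qed
  have nz: "c t \<noteq> 0" if "0 \<le> t" for t using P_pos[OF that] by (auto simp: P_def)
  have length_deriv: "((\<lambda>t. arc_length (norm (c t)) - sqrt (E 0) * t) has_real_derivative 0) (at t)" if "0 \<le> t" for t
  proof -
    have nz_t: "c t \<noteq> 0" by (rule nz[OF that])
    have Q: "Q t = 0" using constant_on_interval[of t Q t] dQ nz Q0 that by simp
    have E: "E t = E 0" using constant_on_interval[of t E t] dE nz that by simp
    have W: "(speed (norm (c t)))\<^sup>2 = 1 + (\<mu> t)\<^sup>2 * (c t \<bullet> c t)"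
      using nz_t by (simp add: speed_def \<mu>_def power_divide dot_square_norm)
    have vc: "(v t \<bullet> v t) * (c t \<bullet> c t) = (P t)\<^sup>2" using Q by (simp add: Q_def)
    have "E 0 * (norm (c t))\<^sup>2 = (v t \<bullet> v t) * (c t \<bullet> c t) + (B t)\<^sup>2 * (c t \<bullet> c t)"
      unfolding E[symmetric] by (simp add: E_def dot_square_norm algebra_simps)
    also have "\<dots> = (P t)\<^sup>2 * (speed (norm (c t)))\<^sup>2"
      unfolding vc W B_eq[OF nz_t] by (simp add: algebra_simps power_mult_distrib)
    finally have "sqrt (E 0 * (norm (c t))\<^sup>2) = sqrt ((P t * speed (norm (c t)))\<^sup>2)"
      by (simp add: power_mult_distrib)
    \<comment> \<open>Positivity of \<open>P\<close> fixes the sign of the square root, so the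
      motion is outward.\<close>
    then have eq: "sqrt (E 0) * norm (c t) = P t * speed (norm (c t))"
      using P_pos[OF that] speed_ge_1[of "norm (c t)"] by (simp add: real_sqrt_mult)
    have "((\<lambda>t. norm (c t)) has_derivative (\<lambda>h. (c t \<bullet> (h *\<^sub>R v t)) / norm (c t))) (at t)"
      by (rule has_derivative_compose[OF c'[unfolded has_vector_derivative_def] has_derivative_norm_nonzero[OF nz_t]])
    moreover have "(\<lambda>h. (c t \<bullet> (h *\<^sub>R v t)) / norm (c t)) = (*) (P t / norm (c t))"
      by (auto simp: P_def)
    ultimately have "((\<lambda>t. norm (c t)) has_real_derivative P t / norm (c t)) (at t)"
      by (simp add: has_field_derivative_def)
    from DERIV_chain2[OF arc_length_has_derivative this] nz_t c_in
    have "((\<lambda>t. arc_length (norm (c t))) has_real_derivative speed (norm (c t)) * (P t / norm (c t))) (at t)"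
      by (simp add: norm_in_radii_iff)
    moreover have "speed (norm (c t)) * (P t / norm (c t)) = sqrt (E 0)"
      using eq nz_t by (simp add: field_simps)
    ultimately show ?thesis by (auto intro!: derivative_eq_intros)
  qed
  show ?thesis
  proof (rule that[of "sqrt (E 0)"])
    show "arc_length (norm (c t)) = arc_length (norm x) + sqrt (E 0) * t" if "0 \<le> t" for t
      using constant_on_interval[of t "\<lambda>t. arc_length (norm (c t)) - sqrt (E 0) * t" t] length_deriv that init
      by simp
  qed (use E0 nz in auto)
qed

text \<open>Completeness supplies, for some nonzero \<open>x\<close> in \<open>D\<close>, a geodesic
  defined for all times that starts radially outward; arc length grows linearly along it and passes
  every bound.\<close>

lemma complete_imp_arc_length_unbounded:
  assumes "geodesically_complete D (graph_map f)"
  obtains t where "t \<in> radii" "0 < t" "arc_length t \<ge> b"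
proof -
  obtain x where x: "x \<in> D" "x \<noteq> 0"
  proof -
    obtain e where e: "e > 0" "ball 0 e \<subseteq> D"
      using open_domain zero_in_domain open_contains_ball by blast
    have "ray (e / 2) \<in> D" using e by (intro subsetD[OF e(2)]) auto
    moreover have "ray (e / 2) \<noteq> 0" using e(1) by (simp add: ray_def axis_eq_0_iff)
    ultimately show ?thesis using that by blast
  qed
  let ?\<Phi> = "graph_map f"
  have inj: "inj_on ?\<Phi> D" by (auto simp: inj_on_def graph_map_def)
  have inv: "inv_into D ?\<Phi> (?\<Phi> x) = x" using inv_into_f_f[OF inj x(1)] .
  \<comment> \<open>The tangent vector over the outward vector \<open>x\<close> at the point
    \<open>x\<close>; projecting to the first component gives back \<open>c\<close> with initial
    velocity \<open>x\<close>.\<close>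
  let ?w = "frechet_derivative ?\<Phi> (at x) x"
  have w: "fst ?w = x"
    using frechet_derivative_at[OF has_derivative_graph_map[OF differentiable[OF x(1)]]] by (metis fst_conv)
  have "?w \<in> tangent_space D ?\<Phi> (?\<Phi> x)" by (auto simp: tangent_space_def inv)
  then obtain \<gamma> where \<gamma>: "geodesic D ?\<Phi> \<gamma>" "\<gamma> 0 = ?\<Phi> x" "(\<gamma> has_vector_derivative ?w) (at 0)"
    using assms x(1) unfolding geodesically_complete_def by blast
  then obtain c where c: "coord_geodesic D (induced_metric ?\<Phi>) c" "\<And>t. \<gamma> t = ?\<Phi> (c t)"
    unfolding geodesic_def by blast
  then obtain v where v: "\<And>t. c t \<in> D" "\<And>t. (c has_vector_derivative v t) (at t)"
    "\<And>t. (v has_vector_derivative (\<chi> k. - (\<Sum>i\<in>UNIV. \<Sum>j\<in>UNIV.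
        christoffel (induced_metric ?\<Phi>) k i j (c t) * v t $ i * v t $ j))) (at t)"
    unfolding coord_geodesic_def by blast
  have c_fst: "c = (\<lambda>t. fst (\<gamma> t))" using c(2) by (auto simp: graph_map_def)
  have "c 0 = x" using \<gamma>(2) by (simp add: c_fst graph_map_def)
  moreover have "v 0 = x"
  proof -
    have "(c has_vector_derivative x) (at 0)"
      using bounded_linear.has_vector_derivative[OF bounded_linear_fst \<gamma>(3)] w c_fst by simp
    then show ?thesis using v(2) vector_derivative_unique_at by blast
  qed
  ultimately obtain a where a: "a > 0" "\<And>t. 0 \<le> t \<Longrightarrow> c t \<noteq> 0"
    "\<And>t. 0 \<le> t \<Longrightarrow> arc_length (norm (c t)) = arc_length (norm x) + a * t"
    using arc_length_along_radial_geodesic[OF v _ _ x(2)] by blast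
  \<comment> \<open>The time at which the linear growth reaches \<open>b\<close>, cut off at 0
    because the growth formula is for nonnegative times.\<close>
  define T where "T = max 0 ((b - arc_length (norm x)) / a)"
  have "a * T \<ge> a * ((b - arc_length (norm x)) / a)" unfolding T_def using a(1) by (intro mult_left_mono) auto
  then have "b - arc_length (norm x) \<le> a * T" using a(1) by simp
  moreover have "T \<ge> 0" by (simp add: T_def)
  ultimately show ?thesis
    using that[of "norm (c T)"] a(2,3)[of T] v(1)[of T] by (simp add: norm_in_radii_iff)
qed

end

section \<open>Integration of radial functions\<close>

text \<open>In dimension n the unit sphere has measure n times the volume of the unit ball; the
  \<open>itself\<close> argument carries the dimension.\<close>

definition sphere_area :: "'a::euclidean_space itself \<Rightarrow> real" where
  "sphere_area _ = unit_ball_vol (real DIM('a)) * real DIM('a)"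

lemma sphere_area_pos: "sphere_area TYPE('a::euclidean_space) > 0"
  by (simp add: sphere_area_def)

text \<open>Polar coordinates for radial functions without a measure on the sphere: half-lines
  generate the Borel sets, and on \<open>{..r}\<close> both measures give the volume of the ball of
  radius \<open>r\<close>.\<close>

lemma distr_norm_lborel:
  "distr lborel borel (norm :: 'a::euclidean_space \<Rightarrow> real)
    = density lborel (\<lambda>r. ennreal (sphere_area TYPE('a) * r ^ (DIM('a) - 1) * indicator {0..} r))"
    (is "?M = ?N")
proof (rule measure_eqI_generator_eq[where E = "range (\<lambda>r::real. {..r})" and \<Omega> = UNIV and A = "\<lambda>i. {..real i}"])
  let ?c = "unit_ball_vol (real DIM('a))" and ?n = "DIM('a)"
  show "Int_stable (range (\<lambda>r::real. {..r}))" by (auto simp: Int_stable_def)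
  have M: "emeasure ?M {..r} = (if r < 0 then 0 else ennreal (?c * r ^ ?n))" for r
  proof -
    have "emeasure ?M {..r} = emeasure lborel (cball (0::'a) r)"
      by (subst emeasure_distr) (auto simp: vimage_def cball_def intro!: arg_cong[of _ _ "emeasure lborel"])
    then show ?thesis by (auto simp: emeasure_cball)
  qed
  have N: "emeasure ?N {..r} = (if r < 0 then 0 else ennreal (?c * r ^ ?n))" for r
  proof -
    have "emeasure ?N {..r} = (\<integral>\<^sup>+s. ennreal (sphere_area TYPE('a) * s ^ (?n - 1) * indicator {0..} s) * indicator {..r} s \<partial>lborel)"
      by (subst emeasure_density) auto
    also have "\<dots> = (\<integral>\<^sup>+s. ennreal (sphere_area TYPE('a) * s ^ (?n - 1)) * indicator {0..r} s \<partial>lborel)"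
      by (rule nn_integral_cong) (auto simp: indicator_def)
    also have "\<dots> = (if r < 0 then 0 else ennreal (?c * r ^ ?n))"
    proof (cases "r < 0")
      case False
      have "(\<integral>\<^sup>+s. ennreal (sphere_area TYPE('a) * s ^ (?n - 1)) * indicator {0..r} s \<partial>lborel)
          = ennreal (?c * r ^ ?n - ?c * 0 ^ ?n)"
      proof (rule nn_integral_FTC_Icc)
        show "((\<lambda>s. ?c * s ^ ?n) has_real_derivative sphere_area TYPE('a) * x ^ (?n - 1)) (at x)" for x
          unfolding sphere_area_def by (auto intro!: derivative_eq_intros)
        show "0 \<le> sphere_area TYPE('a) * x ^ (?n - 1)" if "x \<in> {0..r}" for x
          using that sphere_area_pos[where 'a='a] by auto
      qed (use False in auto)
      then show ?thesis using False by simp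
    qed auto
    finally show ?thesis .
  qed
  show "emeasure ?M X = emeasure ?N X" if "X \<in> range (\<lambda>r::real. {..r})" for X
    using that M N by auto
  show "emeasure ?M {..real i} \<noteq> \<infinity>" for i
    unfolding M by simp
  show "sets ?M = sigma_sets UNIV (range (\<lambda>r::real. {..r}))"
    "sets ?N = sigma_sets UNIV (range (\<lambda>r::real. {..r}))"
    by (simp_all add: borel_eq_atMost)
  show "(\<Union>i. {..real i}) = UNIV" by (auto simp: real_arch_simple)
qed auto

lemma lborel_integral_radial:
  fixes F :: "real \<Rightarrow> real"
  assumes [measurable]: "F \<in> borel_measurable borel" and "\<And>r. r < 0 \<Longrightarrow> F r = 0"
  shows "(\<integral>x. F (norm (x::'a::euclidean_space)) \<partial>lborel)
       = sphere_area TYPE('a) * (\<integral>r. r ^ (DIM('a) - 1) * F r \<partial>lborel)"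
proof -
  have "(\<integral>x. F (norm (x::'a)) \<partial>lborel) = (\<integral>r. F r \<partial>distr lborel borel (norm :: 'a \<Rightarrow> real))"
    by (subst integral_distr) auto
  also have "\<dots> = (\<integral>r. (sphere_area TYPE('a) * r ^ (DIM('a) - 1) * indicator {0..} r) *\<^sub>R F r \<partial>lborel)"
    unfolding distr_norm_lborel
    by (rule integral_density) (auto simp: indicator_def less_imp_le[OF sphere_area_pos])
  also have "\<dots> = (\<integral>r. sphere_area TYPE('a) * (r ^ (DIM('a) - 1) * F r) \<partial>lborel)"
    by (rule Bochner_Integration.integral_cong) (use assms(2) in \<open>auto simp: indicator_def\<close>)
  finally show ?thesis by simp
qed

lemma lborel_integral_annulus:
  fixes F :: "real \<Rightarrow> real"
  assumes "continuous_on {a..b} F" "0 < a"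
  shows "(LINT x:{x. norm x \<in> {a..b}}|lborel. F (norm (x::'a::euclidean_space)))
       = sphere_area TYPE('a) * (LINT r:{a..b}|lborel. r ^ (DIM('a) - 1) * F r)"
proof -
  let ?F = "\<lambda>r. indicator {a..b} r * F r"
  have "(LINT x:{x. norm x \<in> {a..b}}|lborel. F (norm (x::'a))) = (\<integral>x. ?F (norm (x::'a)) \<partial>lborel)"
    by (simp add: set_lebesgue_integral_def indicator_def)
  also have "\<dots> = sphere_area TYPE('a) * (\<integral>r. r ^ (DIM('a) - 1) * ?F r \<partial>lborel)"
  proof (rule lborel_integral_radial)
    show "?F \<in> borel_measurable borel"
      using borel_measurable_continuous_on_indicator[OF _ assms(1)] by simp
    show "?F r = 0" if "r < 0" for r using that assms(2) by simp
  qed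
  finally show ?thesis by (simp add: set_lebesgue_integral_def mult_ac)
qed

lemma set_integral_FTC:
  fixes F f :: "real \<Rightarrow> real"
  assumes "a \<le> b" "\<And>x. a \<le> x \<Longrightarrow> x \<le> b \<Longrightarrow> (F has_real_derivative f x) (at x)"
    "continuous_on {a..b} f"
  shows "(LINT x:{a..b}|lborel. f x) = F b - F a"
proof -
  have "(\<integral>x. indicator {a..b} x *\<^sub>R f x \<partial>lborel) = F b - F a"
    by (rule integral_FTC_Icc[OF assms(1) _ assms(3)])
       (use assms(2) in \<open>auto simp: has_real_derivative_iff_has_vector_derivative[symmetric]
          intro: has_field_derivative_at_within\<close>)
  then show ?thesis by (simp add: set_lebesgue_integral_def)
qed

section \<open>Integration on the graph\<close>

context radial_graph
begin

lemma inj_graph_map: "inj_on (graph_map f) D"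
  by (auto simp: inj_on_def graph_map_def)

lemma continuous_graph_map: "continuous_on D (graph_map f)"
  unfolding graph_map_def[abs_def] by (intro continuous_intros C1_on_continuous[OF C1])

lemma C1_area_element: "Ck_on (Suc 0) D (area_element f)"
  and C1_inverse_area_element: "Ck_on (Suc 0) D (\<lambda>x. inverse (area_element f x))"
proof -
  let ?N = "\<lambda>x. 1 + (\<Sum>i\<in>UNIV. euclidean_grad f x $ i * euclidean_grad f x $ i)"
  have eq: "area_element f x = sqrt (?N x)" for x
    by (simp add: area_element_def power2_norm_eq_inner inner_vec_def)
  have N: "Ck_on (Suc 0) D ?N"
    by (intro C1_on_add C1_on_const C1_on_sum C1_on_mult C1_euclidean_grad)
  have pos: "?N x \<in> {0<..}" for x
    by (simp add: add_pos_nonneg sum_nonneg)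
  have sq: "(sqrt has_vector_derivative inverse (sqrt t) / 2) (at t)" if "t \<in> {0<..}" for t
    using DERIV_real_sqrt[of t] that by (simp add: has_real_derivative_iff_has_vector_derivative)
  have csq: "continuous_on {0<..} (\<lambda>t::real. inverse (sqrt t) / 2)"
    by (intro continuous_intros) auto
  have "Ck_on (Suc 0) D (\<lambda>x. sqrt (?N x))"
    by (rule C1_on_compose(1)[OF N pos sq csq])
  then show W: "Ck_on (Suc 0) D (area_element f)" by (simp only: eq[abs_def])
  have inv: "(inverse has_vector_derivative - (inverse t ^ Suc (Suc 0))) (at t)" if "t \<in> {0<..}" for t :: real
    using DERIV_inverse[of t UNIV] that by (simp add: has_real_derivative_iff_has_vector_derivative)
  have cinv: "continuous_on {0<..} (\<lambda>t::real. - (inverse t ^ Suc (Suc 0)))"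
    by (intro continuous_intros) auto
  show "Ck_on (Suc 0) D (\<lambda>x. inverse (area_element f x))"
    by (rule C1_on_compose(1)[OF W _ inv cinv]) (simp_all add: area_element_pos)
qed

lemma continuous_area_element: "continuous_on D (area_element f)"
  by (rule C1_on_continuous[OF C1_area_element])

lemma volume_eq: "x \<in> D \<Longrightarrow> coord_volume (induced_metric (graph_map f)) x = area_element f x"
  by (rule coord_volume_graph_map[OF differentiable])

text \<open>The values of \<open>h\<close> are prescribed on the graph only, since a test function
  is arbitrary off it. The chart is inverted by \<open>fst\<close>, so \<open>h\<close> is
  \<open>k\<close> after \<open>fst\<close> on the space of the measure, and continuity of
  \<open>k\<close> provides measurability.\<close>

lemma
  fixes h :: "(real^'n) \<times> real \<Rightarrow> 'b::{banach, second_countable_topology}"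
  assumes k: "continuous_on D k" and hk: "\<And>x. x \<in> D \<Longrightarrow> h (graph_map f x) = k x"
  shows measurable_riemannian: "h \<in> borel_measurable (riemannian_measure D (graph_map f))"
    and integral_riemannian: "(\<integral>p. h p \<partial>riemannian_measure D (graph_map f))
        = (LINT x:D|lborel. area_element f x *\<^sub>R k x)"
    and integrable_riemannian: "integrable (riemannian_measure D (graph_map f)) h
        \<longleftrightarrow> set_integrable lborel D (\<lambda>x. area_element f x *\<^sub>R k x)"
proof -
  let ?\<Phi> = "graph_map f" and ?V = "coord_volume (induced_metric (graph_map f))"
  let ?R = "restrict_space lborel D" and ?B = "restrict_space borel (graph_map f ` D)"
  have D: "D \<inter> space lborel \<in> sets lborel" using open_domain by simp
  have spR: "space ?R = D" by (simp add: space_restrict_space)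
  have mR: "borel_measurable ?R = borel_measurable (restrict_space borel D)"
    by (rule measurable_cong_sets) (simp_all add: sets_restrict_space)
  have h: "h \<in> borel_measurable ?B"
  proof -
    have "continuous_on (?\<Phi> ` D) (\<lambda>p. k (fst p))"
      by (rule continuous_on_compose2[OF k]) (auto simp: graph_map_def intro!: continuous_intros)
    then have "(\<lambda>p. k (fst p)) \<in> borel_measurable ?B"
      by (rule borel_measurable_continuous_on_restrict)
    moreover have "h p = k (fst p)" if "p \<in> space ?B" for p
      using that hk by (auto simp: space_restrict_space graph_map_def)
    ultimately show ?thesis by (subst measurable_cong) auto
  qed
  have V: "?V \<in> borel_measurable ?R"
  proof -
    have "area_element f \<in> borel_measurable ?R"
      unfolding mR by (rule borel_measurable_continuous_on_restrict[OF continuous_area_element])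
    then show ?thesis by (subst measurable_cong) (auto simp: spR volume_eq)
  qed
  have Vpos: "AE x in ?R. 0 \<le> ?V x"
    by (rule AE_I2) (simp add: spR volume_eq less_imp_le[OF area_element_pos])
  have \<Phi>: "?\<Phi> \<in> measurable ?R ?B"
  proof -
    have "?\<Phi> \<in> borel_measurable ?R"
      unfolding mR by (rule borel_measurable_continuous_on_restrict[OF continuous_graph_map])
    then show ?thesis by (intro measurable_restrict_space2) (auto simp: spR)
  qed
  then have \<Phi>': "?\<Phi> \<in> measurable (density ?R (\<lambda>x. ennreal (?V x))) ?B"
    by simp
  have h\<Phi>: "(\<lambda>x. h (?\<Phi> x)) \<in> borel_measurable ?R"
    using measurable_compose[OF \<Phi> h] .
  show "h \<in> borel_measurable (riemannian_measure D ?\<Phi>)"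
    using h by (simp add: riemannian_measure_def)
  have eq: "indicator D x *\<^sub>R (?V x *\<^sub>R h (?\<Phi> x)) = indicator D x *\<^sub>R (area_element f x *\<^sub>R k x)" for x
    by (cases "x \<in> D") (simp_all add: volume_eq hk)
  show "(\<integral>p. h p \<partial>riemannian_measure D ?\<Phi>) = (LINT x:D|lborel. area_element f x *\<^sub>R k x)"
    unfolding riemannian_measure_def integral_distr[OF \<Phi>' h] integral_density[OF h\<Phi> V Vpos]
      integral_restrict_space[OF D] eq set_lebesgue_integral_def ..
  show "integrable (riemannian_measure D ?\<Phi>) h
        \<longleftrightarrow> set_integrable lborel D (\<lambda>x. area_element f x *\<^sub>R k x)"
    unfolding riemannian_measure_def integrable_distr_eq[OF \<Phi>' h] integrable_density[OF h\<Phi> V Vpos]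
      integrable_restrict_space[OF D] eq set_integrable_def ..
qed

lemma C1_weighted_grad_smooth:
  fixes v :: "real^'n \<Rightarrow> complex"
  assumes "\<And>j. Ck_on (Suc 0) D (partial_deriv j v)"
  shows "Ck_on (Suc 0) D (\<lambda>x. coord_volume (induced_metric (graph_map f)) x *\<^sub>R
    coord_grad (induced_metric (graph_map f)) v x $ i)"
proof (rule C1_on_cong[OF open_domain])
  show "Ck_on (Suc 0) D (\<lambda>x. area_element f x *\<^sub>R partial_deriv i v x
      - (euclidean_grad f x $ i * inverse (area_element f x)) *\<^sub>R
          (\<Sum>j\<in>UNIV. euclidean_grad f x $ j *\<^sub>R partial_deriv j v x))"
    by (intro C1_on_diff C1_on_scaleR C1_on_mult C1_on_sum C1_area_element C1_inverse_area_element
        C1_euclidean_grad assms)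
qed (simp add: weighted_coord_grad_graph_map[OF differentiable] divide_inverse)

lemma L2_compact_support:
  fixes w :: "real^'n \<Rightarrow> complex"
  assumes K: "compact K" "K \<subseteq> D" and w: "continuous_on D w" "\<And>x. x \<in> D - K \<Longrightarrow> w x = 0"
  shows "(\<lambda>p. w (fst p)) \<in> L2 (riemannian_measure D (graph_map f))" (is "_ \<in> L2 ?\<mu>")
proof -
  have c: "continuous_on D (\<lambda>x. (norm (w x))\<^sup>2)" by (intro continuous_intros w)
  have "set_integrable lborel D (\<lambda>x. area_element f x *\<^sub>R (norm (w x))\<^sup>2)"
    by (rule set_integrable_compact_support[OF continuous_on_scaleR[OF continuous_area_element c] K])
       (simp add: w(2))
  then have "integrable ?\<mu> (\<lambda>p. (norm (w (fst p)))\<^sup>2)"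
    by (subst integrable_riemannian[OF c]) (auto simp: graph_map_def)
  moreover have "(\<lambda>p. w (fst p)) \<in> borel_measurable ?\<mu>"
    by (rule measurable_riemannian[OF w(1)]) (simp add: graph_map_def)
  ultimately show ?thesis by (simp add: L2_def)
qed

text \<open>The classical Laplacian is the distributional one: a test function is pulled back to
  \<open>D\<close>, and Green's formula moves the operator onto \<open>u\<close>. The function
  \<open>l\<close> is a closed formula for the Laplacian on \<open>D\<close>.\<close>

lemma L2_laplacianI:
  fixes u :: "real^'n \<Rightarrow> complex"
  defines "g \<equiv> induced_metric (graph_map f)"
  assumes K: "compact K" "K \<subseteq> D" and u: "Ck_on (Suc 0) D u" "\<And>x. x \<in> D - K \<Longrightarrow> u x = 0"
    and X: "\<And>i. Ck_on (Suc 0) D (\<lambda>x. coord_volume g x *\<^sub>R coord_grad g u x $ i)"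
    and lap: "\<And>x. x \<in> D \<Longrightarrow> coord_laplacian g u x = l x" "continuous_on D l"
      "\<And>x. x \<in> D - K \<Longrightarrow> l x = 0"
  shows "L2_laplacian D (graph_map f) (\<lambda>p. u (fst p)) (\<lambda>p. l (fst p))"
proof -
  let ?\<Phi> = "graph_map f" and ?W = "area_element f"
  let ?\<mu> = "riemannian_measure D ?\<Phi>"
  note L2 = L2_compact_support[OF K]
  have "(\<integral>p. u (fst p) * laplacian D ?\<Phi> \<phi> p \<partial>?\<mu>) = (\<integral>p. l (fst p) * \<phi> p \<partial>?\<mu>)"
    if \<phi>: "\<phi> \<in> test_functions D ?\<Phi>" for \<phi>
  proof -
    define v where "v = \<phi> \<circ> ?\<Phi>"
    have "Ck_on k D v" for k using \<phi> by (simp add: test_functions_def smooth_on_def v_def)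
    from this[of "Suc 0"] this[of "Suc (Suc 0)"]
    have v: "Ck_on (Suc 0) D v" "Ck_on (Suc 0) D (partial_deriv j v)" for j by simp_all
    have Xv: "Ck_on (Suc 0) D (\<lambda>x. coord_volume g x *\<^sub>R coord_grad g v x $ i)" for i
      unfolding g_def by (rule C1_weighted_grad_smooth[OF v(2)])
    have lapv: "continuous_on D (coord_laplacian g v)"
    proof -
      have "continuous_on D (coord_volume g)"
        using continuous_area_element by (rule continuous_on_eq) (simp add: g_def volume_eq)
      then show ?thesis
        unfolding coord_laplacian_def coord_div_def
        by (intro continuous_on_scaleR continuous_on_inverse continuous_on_sum C1_on_continuous_partial[OF Xv])
           (auto simp: g_def volume_eq less_imp_neq[OF area_element_pos, symmetric])
    qed
    have inv: "inv_into D ?\<Phi> (?\<Phi> x) = x" if "x \<in> D" for x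
      using inv_into_f_f[OF inj_graph_map that] .
    have "(\<integral>p. u (fst p) * laplacian D ?\<Phi> \<phi> p \<partial>?\<mu>) = (LINT x:D|lborel. ?W x *\<^sub>R (u x * coord_laplacian g v x))"
      by (rule integral_riemannian[OF continuous_on_mult[OF C1_on_continuous[OF u(1)] lapv]])
         (simp add: laplacian_def inv g_def v_def, simp add: graph_map_def)
    also have "\<dots> = (LINT x:D|lborel. coord_volume g x *\<^sub>R (u x * coord_laplacian g v x))"
      by (rule set_lebesgue_integral_cong) (use open_domain in \<open>auto simp: g_def volume_eq\<close>)
    also have "\<dots> = (LINT x:D|lborel. coord_volume g x *\<^sub>R (coord_laplacian g u x * v x))"
    proof (rule coord_laplacian_symmetric[OF open_domain K _ _ u(1) X u(2) v(1) Xv])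
      show "matrix_inv (g x) $ i $ j = matrix_inv (g x) $ j $ i" if "x \<in> D" for x i j
        by (simp add: g_def matrix_inv_induced_metric_graph_map differentiable[OF that] mult.commute eq_commute)
      show "coord_volume g x \<noteq> 0" if "x \<in> D" for x
        using area_element_pos[of f x] by (simp add: g_def volume_eq that)
    qed
    also have "\<dots> = (LINT x:D|lborel. ?W x *\<^sub>R (l x * v x))"
      by (rule set_lebesgue_integral_cong) (use open_domain in \<open>auto simp: g_def[symmetric] lap(1) volume_eq[folded g_def]\<close>)
    also have "\<dots> = (\<integral>p. l (fst p) * \<phi> p \<partial>?\<mu>)"
      by (rule integral_riemannian[symmetric, OF continuous_on_mult[OF lap(2) C1_on_continuous[OF v(1)]]])
         (simp add: v_def, simp add: graph_map_def)
    finally show ?thesis .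
  qed
  then show ?thesis
    using L2[OF C1_on_continuous[OF u(1)] u(2)] L2[OF lap(2,3)] by (simp add: L2_laplacian_def)
qed

end

section \<open>The Laplace operator on radial functions\<close>

context radial_graph
begin

lemma arc_length_integrable: "t \<in> radii \<Longrightarrow> speed integrable_on {0..t}"
  by (intro integrable_continuous_real continuous_on_subset[OF continuous_speed] radii_interval)

lemma arc_length_mono:
  assumes "0 \<le> r" "r \<le> t" "t \<in> radii"
  shows "arc_length r \<le> arc_length t"
  unfolding arc_length_def
proof (rule integral_subset_le)
  have "r \<in> radii" using radii_downward[OF assms(3), of r] assms by simp
  then show "speed integrable_on {0..r}" by (rule arc_length_integrable)
  show "\<forall>x\<in>{0..t}. 0 \<le> speed x" using speed_ge_1 by (auto intro: order_trans[OF zero_le_one])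
qed (use assms arc_length_integrable in auto)

definition radii_pos :: "real set" where "radii_pos = radii \<inter> {0<..}"

lemma norm_in_radii_pos: "x \<in> D - {0} \<Longrightarrow> norm x \<in> radii_pos"
  using norm_in_radii_iff[of x] by (auto simp: radii_pos_def)

lemma C1_norm_domain: "Ck_on (Suc 0) (D - {0}) norm"
  by (rule C1_on_subset[OF C1_norm]) auto

lemmas C1_on_compose_norm = C1_on_compose[OF C1_norm_domain norm_in_radii_pos]

lemma has_vector_derivative_arc_length:
  "t \<in> radii_pos \<Longrightarrow> (arc_length has_vector_derivative speed t) (at t)"
  using arc_length_has_derivative[of t]
  by (simp add: radii_pos_def has_real_derivative_iff_has_vector_derivative)

lemma continuous_arc_length: "continuous_on radii_pos arc_length"
  by (rule DERIV_continuous_on, rule has_field_derivative_at_within, rule arc_length_has_derivative)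
     (auto simp: radii_pos_def)

lemma annulus:
  assumes "0 < a" "b \<in> radii"
  shows "compact {x :: real^'n. norm x \<in> {a..b}}" "{x. norm x \<in> {a..b}} \<subseteq> D"
proof -
  have "{x :: real^'n. norm x \<in> {a..b}} = cball 0 b - ball 0 a" by auto
  then show "compact {x :: real^'n. norm x \<in> {a..b}}" by (simp add: compact_diff)
  show "{x. norm x \<in> {a..b}} \<subseteq> D"
  proof clarsimp
    fix x :: "real^'n" assume "a \<le> norm x" "norm x \<le> b"
    then have "norm x \<in> radii" using radii_downward[OF assms(2), of "norm x"] by simp
    then show "x \<in> D" by (simp add: norm_in_radii_iff)
  qed
qed

text \<open>The flux of \<open>u\<close> is the field \<open>Z\<close>, that is, H'(s) x / |x|. Its
  divergence is w H'' + (n - 1) / r H', and dividing by the volume density w gives \<open>k\<close>.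
  The vanishing below \<open>arc_length a\<close> makes everything 0 on \<open>ball 0 a\<close>,
  which removes the singularity of the norm.\<close>

lemma L2_laplacian_radial:
  fixes H H' H'' :: "real \<Rightarrow> complex"
  defines "k \<equiv> \<lambda>r. H'' (arc_length r)
      + ((real CARD('n) - 1) / (r * speed r)) *\<^sub>R H' (arc_length r)"
  assumes ab: "0 < a" "a \<le> b" "b \<in> radii"
    and H: "\<And>t. (H has_vector_derivative H' t) (at t)" "\<And>t. (H' has_vector_derivative H'' t) (at t)"
      "continuous_on UNIV H''"
    and zero: "\<And>t. t \<le> arc_length a \<or> arc_length b \<le> t \<Longrightarrow> H t = 0 \<and> H' t = 0 \<and> H'' t = 0"
  shows "L2_laplacian D (graph_map f) (\<lambda>p. H (arc_length (norm (fst p)))) (\<lambda>p. k (norm (fst p)))"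
    and "continuous_on D (\<lambda>x. k (norm x))"
    and "continuous_on D (\<lambda>x. H (arc_length (norm x)))"
    and "\<And>x. x \<in> D - {x. norm x \<in> {a..b}} \<Longrightarrow> H (arc_length (norm x)) = 0 \<and> k (norm x) = 0"
proof -
  let ?g = "induced_metric (graph_map f)" and ?K = "{x :: real^'n. norm x \<in> {a..b}}"
  define u where "u x = H (arc_length (norm x))" for x :: "real^'n"
  define X where "X i x = coord_volume ?g x *\<^sub>R coord_grad ?g u x $ i" for i x
  define m where "m r = inverse r *\<^sub>R H' (arc_length r)" for r
  define m' where "m' r = inverse r *\<^sub>R (speed r *\<^sub>R H'' (arc_length r))
      - (inverse r)\<^sup>2 *\<^sub>R H' (arc_length r)" for r
  define Z where "Z i x = x $ i *\<^sub>R m (norm x)" for i and x :: "real^'n"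
  have cH: "continuous_on UNIV H" "continuous_on UNIV H'"
    using H(1,2) by (auto intro!: continuous_at_imp_continuous_on has_vector_derivative_continuous)
  have cS: "continuous_on radii_pos (\<lambda>r. h (arc_length r))" if "continuous_on UNIV h" for h :: "real \<Rightarrow> complex"
    by (rule continuous_on_compose2[OF that continuous_arc_length]) auto
  have csp: "continuous_on radii_pos speed"
    using continuous_speed by (rule continuous_on_subset) (auto simp: radii_pos_def)
  have nz: "r \<noteq> 0" if "r \<in> radii_pos" for r using that by (auto simp: radii_pos_def)
  have vS: "((\<lambda>r. h (arc_length r)) has_vector_derivative speed r *\<^sub>R h' (arc_length r)) (at r)"
    if "r \<in> radii_pos" "\<And>t. (h has_vector_derivative h' t) (at t)" for h h' :: "real \<Rightarrow> complex" and r
    using vector_diff_chain_at[OF has_vector_derivative_arc_length[OF that(1)] that(2)]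
    by (simp add: o_def)
  have ball: "ball 0 a \<subseteq> D"
  proof
    fix x :: "real^'n" assume "x \<in> ball 0 a"
    then have "norm x \<in> radii" using radii_downward[OF ab(3), of "norm x"] ab by simp
    then show "x \<in> D" by (simp add: norm_in_radii_iff)
  qed
  have D_Un: "(D - {0}) \<union> ball 0 a = D" using ball ab(1) by auto
  have out: "H (arc_length (norm x)) = 0 \<and> H' (arc_length (norm x)) = 0 \<and> H'' (arc_length (norm x)) = 0"
    if "x \<in> D" "norm x \<le> a \<or> b \<le> norm x" for x
  proof (rule zero)
    have "a \<in> radii" using radii_downward[OF ab(3), of a] ab by simp
    then show "arc_length (norm x) \<le> arc_length a \<or> arc_length b \<le> arc_length (norm x)"
      using that arc_length_mono[of "norm x" a] arc_length_mono[of b "norm x"] ab norm_in_radii_iff[of x] by auto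
  qed
  have in_ball: "u x = 0" "Z i x = 0" "k (norm x) = 0" if "x \<in> ball 0 a" for x i
    using out[of x] subsetD[OF ball that] that by (simp_all add: u_def Z_def m_def k_def)
  have zero_K: "u x = 0" "k (norm x) = 0" if "x \<in> D - ?K" for x
    using out[of x] that by (auto simp: u_def k_def)
  \<comment> \<open>The open sets \<open>D - {0}\<close> and \<open>ball 0 a\<close> cover
    \<open>D\<close>: on the first the norm is C^1, on the second the function is 0.\<close>
  have C1_split: "Ck_on (Suc 0) D w" if "Ck_on (Suc 0) (D - {0}) w" "\<And>x. x \<in> ball 0 a \<Longrightarrow> w x = 0"
    for w :: "real^'n \<Rightarrow> complex"
  proof -
    have "Ck_on (Suc 0) (ball 0 a) w"
      by (rule C1_on_cong[OF open_ball C1_on_const[of _ 0]]) (simp add: that(2))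
    from C1_on_Un[OF open_punctured open_ball that(1) this] show ?thesis by (simp only: D_Un)
  qed
  have u': "((\<lambda>r. H (arc_length r)) has_vector_derivative speed r *\<^sub>R H' (arc_length r)) (at r)"
    if "r \<in> radii_pos" for r by (rule vS[OF that H(1)])
  have cu': "continuous_on radii_pos (\<lambda>r. speed r *\<^sub>R H' (arc_length r))"
    by (intro continuous_on_scaleR csp cS cH)
  have du: "partial_deriv i u x = (x $ i / norm x) *\<^sub>R (speed (norm x) *\<^sub>R H' (arc_length (norm x)))"
    if "x \<in> D - {0}" for i x
    using C1_on_compose_norm(2)[OF _ u' cu' that] that by (simp add: u_def[abs_def] partial_deriv_norm)
  have C1u: "Ck_on (Suc 0) D u"
    by (rule C1_split) (use C1_on_compose_norm(1)[OF _ u' cu'] in_ball in \<open>simp_all only: u_def[abs_def]\<close>)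
  have dm: "(m has_vector_derivative m' r) (at r)" if "r \<in> radii_pos" for r
  proof -
    have "(inverse has_real_derivative - ((inverse r)\<^sup>2)) (at r)"
      using DERIV_inverse[OF nz[OF that]] by (simp add: numeral_2_eq_2)
    from has_vector_derivative_scaleR[OF this vS[OF that H(2)]]
    show ?thesis by (simp add: m_def[abs_def] m'_def)
  qed
  have cm: "continuous_on radii_pos m'"
    unfolding m'_def
    by (intro continuous_on_diff continuous_on_scaleR continuous_on_power continuous_on_inverse
        continuous_on_id csp cS cH H(3)) (auto dest: nz)
  have C1m: "Ck_on (Suc 0) (D - {0}) (\<lambda>x. m (norm x))"
    by (rule C1_on_compose_norm(1)[OF _ dm cm])
  have C1Z: "Ck_on (Suc 0) D (Z i)" for i
    by (rule C1_split) (use C1_on_scaleR[OF C1_component C1m] in_ball in \<open>simp_all only: Z_def[abs_def]\<close>)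
  have dZ: "partial_deriv i (Z i) x = m (norm x) + ((x $ i)\<^sup>2 / norm x) *\<^sub>R m' (norm x)" if "x \<in> D - {0}" for i x
  proof -
    have "partial_deriv i (Z i) x = x $ i *\<^sub>R partial_deriv i (\<lambda>x. m (norm x)) x
        + partial_deriv i (\<lambda>x. x $ i) x *\<^sub>R m (norm x)"
      unfolding Z_def[abs_def]
      by (rule partial_deriv_bilinear[OF bounded_bilinear_scaleR C1_component C1m that])
    also have "partial_deriv i (\<lambda>x. m (norm x)) x = (x $ i / norm x) *\<^sub>R m' (norm x)"
      using C1_on_compose_norm(2)[OF _ dm cm that] that by (simp add: partial_deriv_norm)
    finally show ?thesis by (simp add: partial_deriv_component power2_eq_square)
  qed
  have XZ: "X i x = Z i x" if x: "x \<in> D" for i x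
  proof (cases "x \<in> ball 0 a")
    case True
    then have "partial_deriv j u x = 0" for j
      using partial_deriv_cong[OF open_ball True, of u "\<lambda>_. 0"] in_ball by (simp add: partial_deriv_def)
    then show ?thesis using in_ball(2)[OF True] by (simp add: X_def coord_grad_def)
  next
    case False
    then have x0: "x \<in> D - {0}" using x ab(1) by auto
    let ?r = "norm x"
    let ?w = "speed ?r" and ?s = "slope ?r" and ?h = "H' (arc_length ?r)"
    have w: "?w \<noteq> 0" using speed_ge_1[of ?r] by linarith
    have r: "?r \<noteq> 0" using x0 by simp
    have W: "area_element f x = ?w" using x0 by (simp add: area_element_radial)
    have w2: "?w\<^sup>2 = 1 + ?s\<^sup>2" by (simp add: speed_def)
    have G: "euclidean_grad f x $ j = ?s / ?r * x $ j" for j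
      using x0 by (simp add: euclidean_grad_radial)
    have "(\<Sum>j\<in>UNIV. euclidean_grad f x $ j *\<^sub>R partial_deriv j u x)
        = (\<Sum>j\<in>UNIV. (?s * ?w / ?r\<^sup>2 * (x $ j * x $ j)) *\<^sub>R ?h)"
      by (rule sum.cong) (simp_all add: G du[OF x0] power2_eq_square mult_ac)
    also have "\<dots> = (?s * ?w / ?r\<^sup>2 * (x \<bullet> x)) *\<^sub>R ?h"
      by (simp add: scaleR_sum_left[symmetric] sum_distrib_left inner_vec_def)
    also have "\<dots> = (?s * ?w) *\<^sub>R ?h" using r by (simp add: dot_square_norm)
    finally have sum: "(\<Sum>j\<in>UNIV. euclidean_grad f x $ j *\<^sub>R partial_deriv j u x) = (?s * ?w) *\<^sub>R ?h" .
    have "X i x = ?w *\<^sub>R ((x $ i / ?r) *\<^sub>R (?w *\<^sub>R ?h)) - (?s / ?r * x $ i / ?w) *\<^sub>R ((?s * ?w) *\<^sub>R ?h)"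
      unfolding X_def weighted_coord_grad_graph_map[OF differentiable[OF x]] W sum
      unfolding du[OF x0] G ..
    \<comment> \<open>The coefficient \<open>?w\<^sup>2 - ?s\<^sup>2\<close> equals 1, which is how
      \<open>speed\<close> disappears from the flux.\<close>
    also have "\<dots> = ((?w\<^sup>2 - ?s\<^sup>2) * x $ i / ?r) *\<^sub>R ?h"
    proof -
      have "?w * (x $ i / ?r) * ?w - ?s / ?r * x $ i / ?w * (?s * ?w) = (?w\<^sup>2 - ?s\<^sup>2) * x $ i / ?r"
        using w r by (simp add: field_simps power2_eq_square)
      then show ?thesis
        by (simp only: scaleR_scaleR scaleR_left_diff_distrib[symmetric] mult.assoc)
    qed
    finally show ?thesis by (simp add: w2 Z_def m_def divide_inverse)
  qed
  have lap: "coord_laplacian ?g u x = k (norm x)" if x: "x \<in> D" for x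
  proof -
    have "partial_deriv i (X i) x = partial_deriv i (Z i) x" for i
      by (rule partial_deriv_cong[OF open_domain x XZ])
    then have L: "coord_laplacian ?g u x = (\<Sum>i\<in>UNIV. partial_deriv i (Z i) x) /\<^sub>R area_element f x"
      by (simp add: coord_laplacian_def coord_div_def X_def[symmetric] volume_eq[OF x])
    show ?thesis
    proof (cases "x \<in> ball 0 a")
      case True
      then have "partial_deriv i (Z i) x = 0" for i
        using partial_deriv_cong[OF open_ball True, of "Z i" "\<lambda>_. 0"] in_ball by (simp add: partial_deriv_def)
      then show ?thesis using in_ball(3)[OF True] by (simp add: L)
    next
      case False
      then have x0: "x \<in> D - {0}" using x ab(1) by auto
      let ?r = "norm x" and ?n = "real CARD('n)"
      have r: "?r \<noteq> 0" and w: "speed ?r \<noteq> 0" using x0 speed_ge_1[of ?r] by auto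
      have W: "area_element f x = speed ?r" using x0 by (simp add: area_element_radial)
      have "(\<Sum>i\<in>UNIV. partial_deriv i (Z i) x) = ?n *\<^sub>R m ?r + (\<Sum>i\<in>UNIV. (x $ i)\<^sup>2 / ?r) *\<^sub>R m' ?r"
        by (simp add: dZ[OF x0] sum.distrib scaleR_sum_left) (simp add: scaleR_conv_of_real)
      also have "(\<Sum>i\<in>UNIV. (x $ i)\<^sup>2 / ?r) = ?r\<^sup>2 / ?r"
        unfolding sum_divide_distrib[symmetric] power2_norm_eq_inner
        by (simp add: inner_vec_def power2_eq_square)
      also have "?r\<^sup>2 / ?r = ?r" using r by (simp add: power2_eq_square)
      also have "?n *\<^sub>R m ?r + ?r *\<^sub>R m' ?r = speed ?r *\<^sub>R k ?r"
      proof -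
        have 1: "?r *\<^sub>R m' ?r = speed ?r *\<^sub>R H'' (arc_length ?r) - inverse ?r *\<^sub>R H' (arc_length ?r)"
          using r by (simp add: m'_def scaleR_diff_right power2_eq_square mult.assoc[symmetric])
        have 2: "speed ?r *\<^sub>R k ?r = speed ?r *\<^sub>R H'' (arc_length ?r) + ((?n - 1) * inverse ?r) *\<^sub>R H' (arc_length ?r)"
          using w by (simp add: k_def scaleR_add_right divide_inverse)
        show ?thesis unfolding 1 2 by (simp add: m_def left_diff_distrib scaleR_diff_left)
      qed
      finally show ?thesis using w by (simp add: L W)
    qed
  qed
  have ck: "continuous_on D (\<lambda>x. k (norm x))"
  proof -
    have nz_speed: "\<forall>r\<in>radii_pos. r * speed r \<noteq> 0"
    proof
      fix r assume "r \<in> radii_pos"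
      then show "r * speed r \<noteq> 0" using nz[of r] speed_ge_1[of r] by auto
    qed
    have "continuous_on radii_pos k"
      unfolding k_def
      by (intro continuous_on_add continuous_on_scaleR continuous_on_divide continuous_on_const
          continuous_on_mult continuous_on_id csp cS cH H(3) nz_speed)
    then have "continuous_on (D - {0}) (\<lambda>x. k (norm x))"
      by (rule continuous_on_compose2) (use norm_in_radii_pos in \<open>auto intro!: continuous_intros\<close>)
    moreover have "continuous_on (ball (0 :: real^'n) a) (\<lambda>x. k (norm x))"
      using continuous_on_const[of _ 0] by (rule continuous_on_eq) (rule in_ball(3)[symmetric])
    ultimately have "continuous_on ((D - {0}) \<union> ball 0 a) (\<lambda>x. k (norm x))"
      using open_punctured by (intro continuous_on_open_Un) auto
    then show ?thesis by (simp only: D_Un)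
  qed
  then show "continuous_on D (\<lambda>x. k (norm x))" .
  show "continuous_on D (\<lambda>x. H (arc_length (norm x)))"
    using C1_on_continuous[OF C1u] by (simp add: u_def[abs_def])
  show "H (arc_length (norm x)) = 0 \<and> k (norm x) = 0" if "x \<in> D - ?K" for x
    using zero_K[OF that] by (simp add: u_def)
  have "Ck_on (Suc 0) D (X i)" for i
    by (rule C1_on_cong[OF open_domain C1Z]) (simp add: XZ)
  then have "L2_laplacian D (graph_map f) (\<lambda>p. u (fst p)) (\<lambda>p. k (norm (fst p)))"
    by (intro L2_laplacianI[OF annulus[OF ab(1,3)] C1u zero_K(1) _ lap ck zero_K(2)])
       (simp_all only: X_def[abs_def])
  then show "L2_laplacian D (graph_map f) (\<lambda>p. H (arc_length (norm (fst p)))) (\<lambda>p. k (norm (fst p)))"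
    by (simp only: u_def)
qed

lemma L2_norm_radial:
  fixes k :: "real \<Rightarrow> complex"
  assumes ab: "0 < a" "b \<in> radii"
    and k: "continuous_on D (\<lambda>x. k (norm x))" "\<And>x. x \<in> D - {x. norm x \<in> {a..b}} \<Longrightarrow> k (norm x) = 0"
    and ck: "continuous_on {a..b} k"
  shows "(L2_norm (riemannian_measure D (graph_map f)) (\<lambda>p. k (norm (fst p))))\<^sup>2
    = sphere_area TYPE(real^'n) * (LINT r:{a..b}|lborel. r ^ (CARD('n) - 1) * (speed r * (norm (k r))\<^sup>2))"
proof -
  let ?\<mu> = "riemannian_measure D (graph_map f)" and ?K = "{x :: real^'n. norm x \<in> {a..b}}"
  have "{a..b} \<subseteq> radii" using radii_interval[OF ab(2)] ab(1) by auto
  then have csp: "continuous_on {a..b} speed" by (rule continuous_on_subset[OF continuous_speed])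
  have "(L2_norm ?\<mu> (\<lambda>p. k (norm (fst p))))\<^sup>2 = (\<integral>p. (norm (k (norm (fst p))))\<^sup>2 \<partial>?\<mu>)"
    unfolding L2_norm_def by (rule real_sqrt_pow2) (simp add: integral_nonneg_AE)
  also have "\<dots> = (LINT x:D|lborel. area_element f x *\<^sub>R (norm (k (norm x)))\<^sup>2)"
    by (rule integral_riemannian) (auto intro!: continuous_intros k simp: graph_map_def)
  also have "\<dots> = (LINT x:?K|lborel. speed (norm x) * (norm (k (norm x)))\<^sup>2)"
    unfolding set_lebesgue_integral_def
  proof (rule Bochner_Integration.integral_cong[OF refl])
    fix x :: "real^'n"
    show "indicator D x *\<^sub>R (area_element f x *\<^sub>R (norm (k (norm x)))\<^sup>2)
        = indicator ?K x *\<^sub>R (speed (norm x) * (norm (k (norm x)))\<^sup>2)"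
    proof (cases "x \<in> ?K")
      case True
      then have "x \<in> D" "x \<noteq> 0" using annulus(2)[OF ab] ab(1) by auto
      then show ?thesis using True by (simp add: area_element_radial)
    next
      case False
      then show ?thesis using k(2)[of x] by (cases "x \<in> D") auto
    qed
  qed
  also have "\<dots> = sphere_area TYPE(real^'n) * (LINT r:{a..b}|lborel. r ^ (DIM(real^'n) - 1) * (speed r * (norm (k r))\<^sup>2))"
    by (rule lborel_integral_annulus[OF _ ab(1)]) (intro continuous_intros csp ck)
  finally show ?thesis by simp
qed

end

section \<open>Wave packets\<close>

text \<open>At the kink the difference quotient is \<open>max 0 h ^ Suc k\<close>, which tends to
  0.\<close>

lemma DERIV_max_0_power:
  "((\<lambda>y::real. max 0 y ^ Suc (Suc k)) has_real_derivative real (Suc (Suc k)) * max 0 y ^ Suc k) (at y)"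
proof -
  consider "y > 0" | "y < 0" | "y = 0" by linarith
  then show ?thesis
  proof cases
    case 1
    have "((\<lambda>y::real. y ^ Suc (Suc k)) has_real_derivative real (Suc (Suc k)) * y ^ Suc k) (at y)"
      using DERIV_pow[of "Suc (Suc k)" y] by simp
    then have "((\<lambda>y::real. max 0 y ^ Suc (Suc k)) has_real_derivative real (Suc (Suc k)) * y ^ Suc k) (at y)"
      by (rule has_field_derivative_transform_within_open[where S = "{0<..}"]) (use 1 in auto)
    then show ?thesis using 1 by simp
  next
    case 2
    have "((\<lambda>y::real. 0) has_real_derivative 0) (at y)" by simp
    then have "((\<lambda>y::real. max 0 y ^ Suc (Suc k)) has_real_derivative 0) (at y)"
      by (rule has_field_derivative_transform_within_open[where S = "{..<0}"]) (use 2 in auto)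
    then show ?thesis using 2 by simp
  next
    case 3
    have "((\<lambda>h::real. max 0 h ^ Suc k) \<longlongrightarrow> max 0 0 ^ Suc k) (at 0)"
      by (intro tendsto_intros)
    moreover have "\<forall>\<^sub>F h in at 0. max 0 h ^ Suc k = (max 0 (0 + h) ^ Suc (Suc k) - max 0 0 ^ Suc (Suc k)) / (h::real)"
      by (rule eventually_at_filter[THEN iffD2]) (auto simp: max_def)
    ultimately have "((\<lambda>h::real. (max 0 (0 + h) ^ Suc (Suc k) - max 0 0 ^ Suc (Suc k)) / h) \<longlongrightarrow> max 0 0 ^ Suc k) (at 0)"
      by (rule Lim_transform_eventually)
    then show ?thesis using 3 by (simp add: DERIV_def)
  qed
qed

text \<open>The cube is the least integer power of this positive part that is C^2. Being a
  polynomial on the unit interval, it has explicit bounds and an explicit L^2 norm.\<close>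

definition bump :: "real \<Rightarrow> real" where "bump t = max 0 (t * (1 - t)) ^ 3"

definition bump' :: "real \<Rightarrow> real" where "bump' t = 3 * max 0 (t * (1 - t)) ^ 2 * (1 - 2 * t)"

definition bump'' :: "real \<Rightarrow> real" where
  "bump'' t = 6 * max 0 (t * (1 - t)) * (1 - 2 * t)\<^sup>2 - 6 * max 0 (t * (1 - t)) ^ 2"

lemma bump_has_derivative: "(bump has_real_derivative bump' t) (at t)"
proof -
  have "((\<lambda>t. t * (1 - t)) has_real_derivative 1 - 2 * t) (at t)"
    by (auto intro!: derivative_eq_intros)
  from DERIV_chain2[OF DERIV_max_0_power[of 1] this]
  show ?thesis by (simp add: bump_def[abs_def] bump'_def numeral_3_eq_3 numeral_2_eq_2)
qed

lemma bump'_has_derivative: "(bump' has_real_derivative bump'' t) (at t)"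
proof -
  have q: "((\<lambda>t. t * (1 - t)) has_real_derivative 1 - 2 * t) (at t)"
    by (auto intro!: derivative_eq_intros)
  let ?m = "\<lambda>t::real. max 0 (t * (1 - t))"
  have "((\<lambda>t. ?m t ^ 2) has_real_derivative 2 * ?m t * (1 - 2 * t)) (at t)"
    using DERIV_chain2[OF DERIV_max_0_power[of 0] q] by (simp add: numeral_2_eq_2)
  moreover have "((\<lambda>t. 1 - 2 * t) has_real_derivative -2) (at t)"
    by (auto intro!: derivative_eq_intros)
  ultimately have D: "((\<lambda>t. 3 * ?m t ^ 2 * (1 - 2 * t)) has_real_derivative
      3 * (2 * ?m t * (1 - 2 * t)) * (1 - 2 * t) + -2 * (3 * ?m t ^ 2)) (at t)"
    by (intro DERIV_mult DERIV_cmult)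
  have eq: "3 * (2 * m * d) * d + -2 * (3 * m\<^sup>2) = 6 * m * d\<^sup>2 - 6 * m\<^sup>2" for m d :: real
    by (simp add: power2_eq_square)
  show ?thesis
    unfolding bump'_def[abs_def] bump''_def eq[symmetric] by (rule D)
qed

lemma continuous_bump'': "continuous_on S bump''"
  unfolding bump''_def[abs_def] by (intro continuous_intros)

lemma bump_outside:
  assumes "t \<le> 0 \<or> 1 \<le> t"
  shows "bump t = 0" "bump' t = 0" "bump'' t = 0"
proof -
  have "t * (1 - t) \<le> 0" using assms by (auto simp: mult_le_0_iff)
  then have "max 0 (t * (1 - t)) = 0" by simp
  then show "bump t = 0" "bump' t = 0" "bump'' t = 0"
    by (simp_all add: bump_def bump'_def bump''_def)
qed

text \<open>Crude bounds: on the unit interval the positive part and |1 - 2t| are at most 1, so the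
  coefficients 3 and 6 + 6 remain.\<close>

lemma bump_bounds: "\<bar>bump t\<bar> \<le> 1" "\<bar>bump' t\<bar> \<le> 3" "\<bar>bump'' t\<bar> \<le> 12"
proof -
  let ?m = "max 0 (t * (1 - t))"
  have "\<bar>bump t\<bar> \<le> 1 \<and> \<bar>bump' t\<bar> \<le> 3 \<and> \<bar>bump'' t\<bar> \<le> 12"
  proof (cases "0 \<le> t \<and> t \<le> 1")
    case True
    have m: "0 \<le> ?m" "?m \<le> 1" using True by (auto intro: mult_le_one)
    have d: "\<bar>1 - 2 * t\<bar> \<le> 1" using True by auto
    have m2: "0 \<le> ?m ^ k" "?m ^ k \<le> 1" for k using m by (auto intro: power_le_one)
    have d2: "(1 - 2 * t)\<^sup>2 \<le> 1" using d by (simp add: abs_square_le_1)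
    have "?m ^ 2 * \<bar>1 - 2 * t\<bar> \<le> 1" using m2[of 2] d by (intro mult_le_one) auto
    moreover have "0 \<le> ?m * (1 - 2 * t)\<^sup>2" "?m * (1 - 2 * t)\<^sup>2 \<le> 1"
      using m d2 by (auto intro: mult_le_one)
    moreover from this have "\<bar>bump'' t\<bar> \<le> 12"
      unfolding bump''_def mult.assoc using m2[of 2] by linarith
    ultimately show ?thesis
      using m2[of 3] by (auto simp: bump_def bump'_def abs_mult)
  next
    case False
    then show ?thesis using bump_outside[of t] by auto
  qed
  then show "\<bar>bump t\<bar> \<le> 1" "\<bar>bump' t\<bar> \<le> 3" "\<bar>bump'' t\<bar> \<le> 12" by auto
qed

text \<open>Termwise antiderivative of \<open>t\<^sup>6 (1 - t)\<^sup>6\<close>, which is the square of \<^const>\<open>bump\<close> on the unit interval only.\<close>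

definition bump_primitive :: "real \<Rightarrow> real" where
  "bump_primitive t = t^7/7 - 6*t^8/8 + 15*t^9/9 - 20*t^10/10 + 15*t^11/11 - 6*t^12/12 + t^13/13"

lemma bump_primitive_has_derivative:
  assumes "0 \<le> t" "t \<le> 1"
  shows "(bump_primitive has_real_derivative (bump t)\<^sup>2) (at t)"
proof -
  have "(bump_primitive has_real_derivative
      t^6 - 6*t^7 + 15*t^8 - 20*t^9 + 15*t^10 - 6*t^11 + t^12) (at t)"
    unfolding bump_primitive_def[abs_def] by (auto intro!: derivative_eq_intros)
  moreover have "(bump t)\<^sup>2 = t^6 - 6*t^7 + 15*t^8 - 20*t^9 + 15*t^10 - 6*t^11 + t^12"
  proof -
    have eq: "bump t = (t * (1 - t)) ^ 3" using assms by (simp add: bump_def max_def)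
    show ?thesis unfolding eq by (simp add: eval_nat_numeral algebra_simps)
  qed
  ultimately show ?thesis by simp
qed

text \<open>The second value is the Beta integral 6! 6! / 13!.\<close>

lemma bump_primitive_0_1: "bump_primitive 0 = 0" "bump_primitive 1 = 1 / 12012"
  by (simp_all add: bump_primitive_def)

text \<open>The window has start \<open>\<alpha>\<close> and length \<open>L\<close> in arc length,
  and \<open>\<kappa>\<close> is the frequency of the wave that the bump modulates.\<close>

definition packet :: "real \<Rightarrow> real \<Rightarrow> real \<Rightarrow> real \<Rightarrow> complex" where
  "packet \<kappa> \<alpha> L t = bump ((t - \<alpha>) / L) *\<^sub>R cis (\<kappa> * t)"

definition packet' :: "real \<Rightarrow> real \<Rightarrow> real \<Rightarrow> real \<Rightarrow> complex" where
  "packet' \<kappa> \<alpha> L t = (bump' ((t - \<alpha>) / L) / L) *\<^sub>R cis (\<kappa> * t)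
     + bump ((t - \<alpha>) / L) *\<^sub>R (\<kappa> *\<^sub>R (\<i> * cis (\<kappa> * t)))"

text \<open>The second derivative, with the multiple of \<open>packet\<close> kept apart because it
  cancels in the approximate eigenvalue equation.\<close>

definition packet'' :: "real \<Rightarrow> real \<Rightarrow> real \<Rightarrow> real \<Rightarrow> complex" where
  "packet'' \<kappa> \<alpha> L t = (bump'' ((t - \<alpha>) / L) / L\<^sup>2) *\<^sub>R cis (\<kappa> * t)
     + (2 * (bump' ((t - \<alpha>) / L) / L)) *\<^sub>R (\<kappa> *\<^sub>R (\<i> * cis (\<kappa> * t)))
     - (\<kappa>\<^sup>2) *\<^sub>R packet \<kappa> \<alpha> L t"

context
  fixes \<kappa> \<alpha> L :: real
  assumes L: "L > 0"
begin

lemma scaled_has_derivative: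
  assumes "\<And>t. (h has_real_derivative h' t) (at t)"
  shows "((\<lambda>t. h ((t - \<alpha>) / L)) has_real_derivative h' ((t - \<alpha>) / L) / L) (at t)"
proof -
  have "((\<lambda>t. (t - \<alpha>) / L) has_real_derivative 1 / L) (at t)"
    using L by (auto intro!: derivative_eq_intros)
  from DERIV_chain2[OF assms this] show ?thesis by simp
qed

lemma cis_has_vector_derivative:
  "((\<lambda>t. cis (\<kappa> * t)) has_vector_derivative \<kappa> *\<^sub>R (\<i> * cis (\<kappa> * t))) (at t)"
proof -
  have "((\<lambda>t. \<kappa> * t) has_derivative (\<lambda>h. \<kappa> * h)) (at t)"
    by (auto intro!: derivative_eq_intros)
  from has_derivative_cis[OF this] show ?thesis
    by (simp add: has_vector_derivative_def mult.commute)
qed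

lemma packet_has_derivative: "(packet \<kappa> \<alpha> L has_vector_derivative packet' \<kappa> \<alpha> L t) (at t)"
  using has_vector_derivative_scaleR[OF scaled_has_derivative[OF bump_has_derivative] cis_has_vector_derivative, of t]
  by (simp add: packet_def[abs_def] packet'_def add.commute)

lemma packet'_has_derivative: "(packet' \<kappa> \<alpha> L has_vector_derivative packet'' \<kappa> \<alpha> L t) (at t)"
proof -
  let ?t = "(t - \<alpha>) / L" and ?E = "cis (\<kappa> * t)"
  have b': "((\<lambda>t. bump' ((t - \<alpha>) / L) / L) has_real_derivative bump'' ?t / L\<^sup>2) (at t)"
    using DERIV_cdivide[OF scaled_has_derivative[OF bump'_has_derivative, of t], of L]
    by (simp add: power2_eq_square)
  have E': "((\<lambda>t. \<kappa> *\<^sub>R (\<i> * cis (\<kappa> * t))) has_vector_derivative \<kappa> *\<^sub>R (\<i> * (\<kappa> *\<^sub>R (\<i> * ?E)))) (at t)"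
    by (intro bounded_linear.has_vector_derivative[OF bounded_linear_scaleR_right]
        bounded_linear.has_vector_derivative[OF bounded_linear_mult_right] cis_has_vector_derivative)
  have "(packet' \<kappa> \<alpha> L has_vector_derivative
      ((bump' ?t / L) *\<^sub>R (\<kappa> *\<^sub>R (\<i> * ?E)) + (bump'' ?t / L\<^sup>2) *\<^sub>R ?E)
      + (bump ?t *\<^sub>R (\<kappa> *\<^sub>R (\<i> * (\<kappa> *\<^sub>R (\<i> * ?E)))) + (bump' ?t / L) *\<^sub>R (\<kappa> *\<^sub>R (\<i> * ?E)))) (at t)"
    unfolding packet'_def[abs_def]
    by (intro has_vector_derivative_add has_vector_derivative_scaleR b' E' cis_has_vector_derivative
        scaled_has_derivative[OF bump_has_derivative])
  moreover have "\<i> * (\<kappa> *\<^sub>R (\<i> * ?E)) = - \<kappa> *\<^sub>R ?E"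
    by (simp add: complex_eq_iff)
  ultimately show ?thesis
    by (simp add: packet''_def packet_def power2_eq_square scaleR_2[symmetric] algebra_simps)
qed

lemma continuous_packet'': "continuous_on S (packet'' \<kappa> \<alpha> L)"
proof -
  have "continuous_on UNIV bump" "continuous_on UNIV bump'"
    using bump_has_derivative bump'_has_derivative by (auto intro!: DERIV_continuous_on)
  then have "continuous_on S (\<lambda>t. b ((t - \<alpha>) / L))" if "b \<in> {bump, bump', bump''}" for b
    using that continuous_bump''[of UNIV] L
    by (auto intro!: continuous_on_compose2[where f = "\<lambda>t. (t - \<alpha>) / L"] continuous_intros)
  then show ?thesis
    unfolding packet''_def[abs_def] packet_def using L
    by (intro continuous_intros) auto
qed

lemma packet_outside:
  assumes "t \<le> \<alpha> \<or> \<alpha> + L \<le> t"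
  shows "packet \<kappa> \<alpha> L t = 0 \<and> packet' \<kappa> \<alpha> L t = 0 \<and> packet'' \<kappa> \<alpha> L t = 0"
proof -
  have "(t - \<alpha>) / L \<le> 0 \<or> 1 \<le> (t - \<alpha>) / L"
    using assms L by (auto simp: field_simps)
  then show ?thesis using bump_outside by (simp add: packet_def packet'_def packet''_def)
qed

lemma norm_packet: "norm (packet \<kappa> \<alpha> L t) = \<bar>bump ((t - \<alpha>) / L)\<bar>"
  by (simp add: packet_def)

lemma norm_packet':
  assumes "L \<ge> 1" shows "norm (packet' \<kappa> \<alpha> L t) \<le> 3 + \<bar>\<kappa>\<bar>"
proof -
  let ?t = "(t - \<alpha>) / L"
  have "norm (packet' \<kappa> \<alpha> L t) \<le> \<bar>bump' ?t\<bar> / L + \<bar>bump ?t\<bar> * \<bar>\<kappa>\<bar>"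
    unfolding packet'_def by (rule order_trans[OF norm_triangle_ineq]) (use L in \<open>simp add: norm_mult abs_mult\<close>)
  also have "\<bar>bump' ?t\<bar> / L \<le> 3 / 1"
    using bump_bounds(2)[of ?t] assms by (intro frac_le) auto
  also have "\<bar>bump ?t\<bar> * \<bar>\<kappa>\<bar> \<le> 1 * \<bar>\<kappa>\<bar>"
    using bump_bounds(1)[of ?t] by (intro mult_right_mono) auto
  finally show ?thesis by simp
qed

text \<open>Only terms that differentiate the bump survive, and each carries a factor 1 / L; the
  term with 1 / L^2 is absorbed by \<open>L \<ge> 1\<close>. The constants are 12 and 2 * 3 from
  \<open>bump_bounds\<close>.\<close>

lemma norm_packet_eigen:
  assumes "L \<ge> 1"
  shows "norm (packet'' \<kappa> \<alpha> L t + (\<kappa>\<^sup>2) *\<^sub>R packet \<kappa> \<alpha> L t) \<le> (12 + 6 * \<bar>\<kappa>\<bar>) / L"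
proof -
  let ?t = "(t - \<alpha>) / L"
  have "packet'' \<kappa> \<alpha> L t + (\<kappa>\<^sup>2) *\<^sub>R packet \<kappa> \<alpha> L t = (bump'' ?t / L\<^sup>2) *\<^sub>R cis (\<kappa> * t)
     + (2 * (bump' ?t / L)) *\<^sub>R (\<kappa> *\<^sub>R (\<i> * cis (\<kappa> * t)))"
    by (simp add: packet''_def)
  also have "norm \<dots> \<le> \<bar>bump'' ?t\<bar> / L\<^sup>2 + 2 * (\<bar>bump' ?t\<bar> / L) * \<bar>\<kappa>\<bar>"
    by (rule order_trans[OF norm_triangle_ineq]) (use L in \<open>simp add: norm_mult abs_mult\<close>)
  also have "\<bar>bump'' ?t\<bar> / L\<^sup>2 \<le> 12 / L"
    using bump_bounds(3)[of ?t] assms by (intro frac_le) (auto simp: power2_eq_square)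
  also have "2 * (\<bar>bump' ?t\<bar> / L) * \<bar>\<kappa>\<bar> \<le> 2 * (3 / L) * \<bar>\<kappa>\<bar>"
    using bump_bounds(2)[of ?t] assms by (intro mult_right_mono mult_left_mono divide_right_mono) auto
  finally show ?thesis by (simp add: add_divide_distrib)
qed

end

section \<open>The spectrum\<close>

lemma L2_norm_cong_AE:
  assumes "u \<in> L2 \<mu>" "v \<in> L2 \<mu>" "AE p in \<mu>. u p = v p"
  shows "L2_norm \<mu> u = L2_norm \<mu> v"
proof -
  have [measurable]: "u \<in> borel_measurable \<mu>" "v \<in> borel_measurable \<mu>"
    using assms(1,2) by (simp_all add: L2_def)
  have "(\<integral>p. (norm (u p))\<^sup>2 \<partial>\<mu>) = (\<integral>p. (norm (v p))\<^sup>2 \<partial>\<mu>)"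
    by (rule integral_cong_AE) (use assms(3) in auto)
  then show ?thesis by (simp add: L2_norm_def)
qed

lemma L2_norm_nonneg: "L2_norm \<mu> u \<ge> 0"
  by (simp add: L2_norm_def integral_nonneg_AE)

context radial_graph
begin

text \<open>Quantitative form of the packet estimate. The remainder \<open>?h\<close> satisfies a
  bound A 2^N a^N M (1 + 1 / r0) that does not grow with \<open>L\<close>, while the squared norm of
  the packet is at least A a^N L / 12012. The common factor A a^N cancels, so the position of the
  window is irrelevant once it lies beyond \<open>r\<^sub>0\<close>.\<close>

lemma no_bounded_inverse:
  assumes r0: "r\<^sub>0 > 0"
    and windows: "\<And>L. L \<ge> 1 \<Longrightarrow> \<exists>a b. r\<^sub>0 \<le> a \<and> a \<le> b \<and> b \<le> 2 * a \<and> b \<in> radii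
        \<and> arc_length b = arc_length a + L"
    and l: "l \<ge> 0"
  shows "\<not> has_bounded_inverse (riemannian_measure D (graph_map f)) (shifted_laplacian D (graph_map f) l)"
proof
  let ?\<mu> = "riemannian_measure D (graph_map f)"
  assume "has_bounded_inverse ?\<mu> (shifted_laplacian D (graph_map f) l)"
  then obtain S where S: "L2_bounded_operator ?\<mu> S"
    "\<And>u h. shifted_laplacian D (graph_map f) l u h \<Longrightarrow> AE p in ?\<mu>. S h p = u p"
    unfolding has_bounded_inverse_def by blast
  then obtain C where C: "\<And>h. h \<in> L2 ?\<mu> \<Longrightarrow> L2_norm ?\<mu> (S h) \<le> C * L2_norm ?\<mu> h"
    and S_L2: "\<And>h. h \<in> L2 ?\<mu> \<Longrightarrow> S h \<in> L2 ?\<mu>"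
    unfolding L2_bounded_operator_def by blast
  define \<kappa> where "\<kappa> = sqrt l"
  define n where "n = real CARD('n)"
  define N where "N = CARD('n) - 1"
  define A where "A = sphere_area TYPE(real^'n)"
  \<comment> \<open>The two summands come from (x + y)^2 \<le> 2 x^2 + 2 y^2, applied to the error
    of the packet and to the first-order term; their sum bounds either coefficient.\<close>
  define M where "M = 2 * (12 + 6 * \<kappa>)\<^sup>2 + 2 * (n * (3 + \<kappa>))\<^sup>2"
  define B where "B = 12012 * (C\<^sup>2 * (2 ^ N * (M * (1 + 1 / r\<^sub>0))))"
  \<comment> \<open>The final comparison gives \<open>L \<le> B\<close>. Since \<open>B\<close>
    depends on neither \<open>L\<close> nor the window, this choice is contradictory.\<close>
  define L where "L = B + 1"
  have \<kappa>: "\<kappa> \<ge> 0" "\<kappa>\<^sup>2 = l" using l by (simp_all add: \<kappa>_def)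
  have n: "n \<ge> 1" by (simp add: n_def)
  have A: "A > 0" by (simp add: A_def sphere_area_pos)
  have M: "M \<ge> 0" by (simp add: M_def)
  have "B \<ge> 0" using M r0 by (simp add: B_def)
  then have L: "L \<ge> 1" by (simp add: L_def)
  then have L0: "L > 0" by simp
  obtain a b where ab: "r\<^sub>0 \<le> a" "a \<le> b" "b \<le> 2 * a" "b \<in> radii" "arc_length b = arc_length a + L"
    using windows[OF L] by blast
  have a0: "a > 0" using r0 ab(1) by simp
  define \<alpha> where "\<alpha> = arc_length a"
  define H where "H = packet \<kappa> \<alpha> L"
  define H' where "H' = packet' \<kappa> \<alpha> L"
  define H'' where "H'' = packet'' \<kappa> \<alpha> L"
  define k where "k r = H'' (arc_length r) + ((n - 1) / (r * speed r)) *\<^sub>R H' (arc_length r)" for r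
  define h where "h r = k r + of_real l * H (arc_length r)" for r
  have H: "(H has_vector_derivative H' t) (at t)" "(H' has_vector_derivative H'' t) (at t)" for t
    unfolding H_def H'_def H''_def
    by (rule packet_has_derivative[OF L0] packet'_has_derivative[OF L0])+
  have zero: "H t = 0 \<and> H' t = 0 \<and> H'' t = 0" if "t \<le> arc_length a \<or> arc_length b \<le> t" for t
    unfolding H_def H'_def H''_def
    by (rule packet_outside[OF L0]) (use that ab(5) in \<open>simp add: \<alpha>_def\<close>)
  have cH'': "continuous_on UNIV H''" unfolding H''_def by (rule continuous_packet''[OF L0])
  let ?K = "{x :: real^'n. norm x \<in> {a..b}}"
  note rad = L2_laplacian_radial[OF a0 ab(2,4) H cH'' zero, folded n_def, folded k_def]
  have rad4: "H (arc_length (norm x)) = 0" "k (norm x) = 0" if "x \<in> D - ?K" for x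
    using rad(4)[OF _ that] by simp_all
  have lap: "L2_laplacian D (graph_map f) (\<lambda>p. H (arc_length (norm (fst p)))) (\<lambda>p. k (norm (fst p)))"
    and ck: "continuous_on D (\<lambda>x. k (norm x))" and cu: "continuous_on D (\<lambda>x. H (arc_length (norm x)))"
    using rad(1-3) by simp_all
  have ch: "continuous_on D (\<lambda>x. h (norm x))"
    unfolding h_def by (intro continuous_intros ck cu)
  have h0: "h (norm x) = 0" if "x \<in> D - ?K" for x
    unfolding h_def using rad4[OF that] by simp
  let ?u = "\<lambda>p :: (real^'n) \<times> real. H (arc_length (norm (fst p)))" and ?h = "\<lambda>p :: (real^'n) \<times> real. h (norm (fst p))"
  have "shifted_laplacian D (graph_map f) l ?u ?h"
    unfolding shifted_laplacian_def h_def using lap by blast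
  then have ae: "AE p in ?\<mu>. S ?h p = ?u p" by (rule S(2))
  have hL2: "?h \<in> L2 ?\<mu>"
    by (rule L2_compact_support[OF annulus[OF a0 ab(4)] ch h0])
  have uL2: "?u \<in> L2 ?\<mu>" using lap by (simp add: L2_laplacian_def)
  have "L2_norm ?\<mu> ?u = L2_norm ?\<mu> (S ?h)"
    by (rule L2_norm_cong_AE[OF S_L2[OF hL2] uL2 ae, symmetric])
  also have "\<dots> \<le> C * L2_norm ?\<mu> ?h" by (rule C[OF hL2])
  \<comment> \<open>Squaring is legitimate for any sign of \<open>C\<close>, because the smaller
    side is nonnegative.\<close>
  finally have "(L2_norm ?\<mu> ?u)\<^sup>2 \<le> (C * L2_norm ?\<mu> ?h)\<^sup>2"
    using L2_norm_nonneg by (intro power_mono)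
  then have main: "(L2_norm ?\<mu> ?u)\<^sup>2 \<le> C\<^sup>2 * (L2_norm ?\<mu> ?h)\<^sup>2" by (simp add: power_mult_distrib)

  have ab_radii: "r \<in> radii" "0 < r" if "r \<in> {a..b}" for r
    using that a0 radii_interval[OF ab(4)] by auto
  have ds: "(arc_length has_real_derivative speed r) (at r)" if "r \<in> {a..b}" for r
    using arc_length_has_derivative ab_radii[OF that] by blast
  have cs: "continuous_on {a..b} arc_length"
    by (rule DERIV_continuous_on, rule has_field_derivative_at_within, rule ds)
  have csp: "continuous_on {a..b} speed"
    by (rule continuous_on_subset[OF continuous_speed]) (use ab_radii in auto)
  have cH: "continuous_on UNIV H" "continuous_on UNIV H'"
    using H by (auto intro!: continuous_at_imp_continuous_on has_vector_derivative_continuous)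
  have comp: "continuous_on {a..b} (\<lambda>r. g (arc_length r))" if "continuous_on UNIV g" for g :: "real \<Rightarrow> complex"
    by (rule continuous_on_compose2[OF that cs]) auto
  have ch_ab: "continuous_on {a..b} h"
  proof -
    have "\<forall>r\<in>{a..b}. r * speed r \<noteq> 0"
    proof
      fix r assume "r \<in> {a..b}"
      then show "r * speed r \<noteq> 0" using a0 speed_ge_1[of r] by auto
    qed
    then show ?thesis unfolding h_def[abs_def] k_def
      by (intro continuous_on_add continuous_on_scaleR continuous_on_divide continuous_on_const
          continuous_on_mult continuous_on_id csp comp cH cH'')
  qed
  have frac: "0 \<le> (arc_length r - \<alpha>) / L" "(arc_length r - \<alpha>) / L \<le> 1" if "r \<in> {a..b}" for r
    using arc_length_mono[of a r] arc_length_mono[of r b] that a0 ab_radii[OF that] ab L0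
    by (auto simp: \<alpha>_def divide_le_eq)
  note integrable = borel_integrable_atLeastAtMost'

  have upper: "(L2_norm ?\<mu> ?h)\<^sup>2 \<le> A * (2 ^ N * a ^ N * (M * (1 + 1 / r\<^sub>0)))"
  proof -
    \<comment> \<open>One factor \<open>speed r\<close> comes from the volume density. It turns the
      square of 1 / (r w) into 1 / (r^2 w), which is at most 1 / a^2. Both terms then have explicit
      primitives.\<close>
    have bound: "speed r * (norm (h r))\<^sup>2 \<le> M * (speed r / L\<^sup>2 + 1 / a\<^sup>2)" if r: "r \<in> {a..b}" for r
    proof -
      let ?w = "speed r" and ?P = "(12 + 6 * \<kappa>) / L" and ?Q = "(n * (3 + \<kappa>)) / (r * speed r)"
      have w: "?w \<ge> 1" by (rule speed_ge_1)
      have rpos: "r > 0" using r a0 by simp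
      have square: "(x + y)\<^sup>2 \<le> 2 * x\<^sup>2 + 2 * y\<^sup>2" for x y :: real
        using zero_le_power2[of "x - y"] by (simp add: power2_eq_square algebra_simps)
      have "h r = (H'' (arc_length r) + (\<kappa>\<^sup>2) *\<^sub>R H (arc_length r)) + ((n - 1) / (r * ?w)) *\<^sub>R H' (arc_length r)"
        by (simp add: h_def k_def \<kappa>(2) scaleR_conv_of_real)
      also have "norm \<dots> \<le> ?P + (n - 1) / (r * ?w) * (3 + \<kappa>)"
      proof (rule order_trans[OF norm_triangle_ineq add_mono])
        show "norm (H'' (arc_length r) + \<kappa>\<^sup>2 *\<^sub>R H (arc_length r)) \<le> ?P"
          using norm_packet_eigen[OF L0 L, of \<kappa> \<alpha>] \<kappa>(1) by (simp add: H''_def H_def)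
        have "norm (H' (arc_length r)) \<le> 3 + \<kappa>"
          using norm_packet'[OF L0 L, of \<kappa> \<alpha>] \<kappa>(1) by (simp add: H'_def)
        then show "norm (((n - 1) / (r * ?w)) *\<^sub>R H' (arc_length r)) \<le> (n - 1) / (r * ?w) * (3 + \<kappa>)"
          using n w rpos by (auto intro!: divide_right_mono mult_left_mono)
      qed
      also have "(n - 1) / (r * ?w) * (3 + \<kappa>) \<le> ?Q"
        using n w rpos \<kappa>(1) by (auto intro!: divide_right_mono mult_right_mono)
      finally have "norm (h r) \<le> ?P + ?Q" by simp
      then have "(norm (h r))\<^sup>2 \<le> (?P + ?Q)\<^sup>2" by (intro power_mono) auto
      also have "\<dots> \<le> 2 * ?P\<^sup>2 + 2 * ?Q\<^sup>2" by (rule square)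
      finally have "?w * (norm (h r))\<^sup>2 \<le> ?w * (2 * ?P\<^sup>2 + 2 * ?Q\<^sup>2)"
        using w by (intro mult_left_mono) auto
      also have "\<dots> = 2 * (12 + 6 * \<kappa>)\<^sup>2 * (?w / L\<^sup>2) + 2 * (n * (3 + \<kappa>))\<^sup>2 * (1 / (r\<^sup>2 * ?w))"
        using w rpos L0 by (simp add: power_divide power_mult_distrib field_simps power2_eq_square)
      also have "\<dots> \<le> M * (?w / L\<^sup>2) + M * (1 / a\<^sup>2)"
      proof (intro add_mono mult_mono)
        have "a\<^sup>2 * 1 \<le> r\<^sup>2 * ?w" using r a0 w by (intro mult_mono power_mono) auto
        then show "1 / (r\<^sup>2 * ?w) \<le> 1 / a\<^sup>2" using a0 by (intro frac_le) auto
      qed (use w M in \<open>auto simp: M_def\<close>)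
      finally show ?thesis by (simp add: algebra_simps)
    qed
    have "(L2_norm ?\<mu> ?h)\<^sup>2 = A * (LINT r:{a..b}|lborel. r ^ N * (speed r * (norm (h r))\<^sup>2))"
      unfolding A_def N_def by (rule L2_norm_radial[OF a0 ab(4) ch h0 ch_ab])
    also have "(LINT r:{a..b}|lborel. r ^ N * (speed r * (norm (h r))\<^sup>2))
        \<le> (LINT r:{a..b}|lborel. b ^ N * (M * (speed r / L\<^sup>2 + 1 / a\<^sup>2)))"
    proof (rule set_integral_mono)
      show "set_integrable lborel {a..b} (\<lambda>r. r ^ N * (speed r * (norm (h r))\<^sup>2))"
        by (intro integrable continuous_intros csp ch_ab)
      show "set_integrable lborel {a..b} (\<lambda>r. b ^ N * (M * (speed r / L\<^sup>2 + 1 / a\<^sup>2)))"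
        using L0 a0 by (intro integrable continuous_intros csp) auto
      show "r ^ N * (speed r * (norm (h r))\<^sup>2) \<le> b ^ N * (M * (speed r / L\<^sup>2 + 1 / a\<^sup>2))" if "r \<in> {a..b}" for r
        using that a0 speed_ge_1[of r] by (intro mult_mono bound power_mono) auto
    qed
    also have "(LINT r:{a..b}|lborel. b ^ N * (M * (speed r / L\<^sup>2 + 1 / a\<^sup>2)))
        = b ^ N * (M * (arc_length b / L\<^sup>2 + b / a\<^sup>2)) - b ^ N * (M * (arc_length a / L\<^sup>2 + a / a\<^sup>2))"
    proof (rule set_integral_FTC[OF ab(2)])
      show "((\<lambda>r. b ^ N * (M * (arc_length r / L\<^sup>2 + r / a\<^sup>2))) has_real_derivative
          b ^ N * (M * (speed r / L\<^sup>2 + 1 / a\<^sup>2))) (at r)" if "a \<le> r" "r \<le> b" for r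
      proof -
        have "((\<lambda>r. arc_length r / L\<^sup>2) has_real_derivative speed r / L\<^sup>2) (at r)"
          by (rule DERIV_cdivide[OF ds]) (use that in simp)
        moreover have "((\<lambda>r. r / a\<^sup>2) has_real_derivative 1 / a\<^sup>2) (at r)"
          by (rule DERIV_cdivide[OF DERIV_ident])
        ultimately show ?thesis by (intro DERIV_cmult DERIV_add)
      qed
      show "continuous_on {a..b} (\<lambda>r. b ^ N * (M * (speed r / L\<^sup>2 + 1 / a\<^sup>2)))"
        using L0 a0 by (intro continuous_intros csp) auto
    qed
    also have "\<dots> = b ^ N * (M * (1 / L + (b - a) / a\<^sup>2))"
      unfolding ab(5) using L0 a0 by (simp add: field_simps power2_eq_square)
    \<comment> \<open>The condition \<open>b \<le> 2 * a\<close> enters twice: it bounds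
      \<open>b ^ N\<close>, and it bounds \<open>(b - a) / a\<^sup>2\<close> by
      \<open>1 / a\<close>.\<close>
    also have "\<dots> \<le> (2 * a) ^ N * (M * (1 + 1 / r\<^sub>0))"
    proof (intro mult_mono power_mono add_mono)
      show "1 / L \<le> 1" using L by simp
      have "(b - a) / a\<^sup>2 \<le> a / a\<^sup>2" using ab(3) by (intro divide_right_mono) auto
      also have "\<dots> = 1 / a" using a0 by (simp add: power2_eq_square)
      also have "\<dots> \<le> 1 / r\<^sub>0" using ab(1) r0 by (intro divide_left_mono) auto
      finally show "(b - a) / a\<^sup>2 \<le> 1 / r\<^sub>0" .
    qed (use M ab a0 L0 r0 in auto)
    finally show ?thesis using A by (simp add: power_mult_distrib)
  qed

  have lower: "A * (a ^ N * (L / 12012)) \<le> (L2_norm ?\<mu> ?u)\<^sup>2"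
  proof -
    let ?b = "\<lambda>r. (bump ((arc_length r - \<alpha>) / L))\<^sup>2"
    have cb: "continuous_on {a..b} ?b"
    proof -
      have "continuous_on UNIV bump" using bump_has_derivative by (auto intro!: DERIV_continuous_on)
      then have "continuous_on {a..b} (\<lambda>r. bump ((arc_length r - \<alpha>) / L))"
        by (rule continuous_on_compose2) (use L0 in \<open>auto intro!: continuous_intros cs\<close>)
      then show ?thesis by (intro continuous_intros)
    qed
    \<comment> \<open>Arc length as variable: the density \<open>speed\<close> makes the integrand
      the derivative of the rescaled \<open>bump_primitive\<close>, whose argument runs from 0 to 1
      over the window.\<close>
    have "(LINT r:{a..b}|lborel. a ^ N * (speed r * ?b r))
        = a ^ N * (L * bump_primitive ((arc_length b - \<alpha>) / L)) - a ^ N * (L * bump_primitive ((arc_length a - \<alpha>) / L))"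
    proof (rule set_integral_FTC[OF ab(2)])
      show "((\<lambda>r. a ^ N * (L * bump_primitive ((arc_length r - \<alpha>) / L))) has_real_derivative
          a ^ N * (speed r * ?b r)) (at r)" if "a \<le> r" "r \<le> b" for r
      proof -
        have r: "r \<in> {a..b}" using that by simp
        have "((\<lambda>r. (arc_length r - \<alpha>) / L) has_real_derivative (speed r - 0) / L) (at r)"
          by (intro DERIV_cdivide DERIV_diff DERIV_const ds[OF r])
        from DERIV_chain2[OF bump_primitive_has_derivative[OF frac[OF r]] this]
        have "((\<lambda>r. a ^ N * (L * bump_primitive ((arc_length r - \<alpha>) / L))) has_real_derivative
            a ^ N * (L * (?b r * ((speed r - 0) / L)))) (at r)"
          by (intro DERIV_cmult)
        then show ?thesis using L0 by (simp add: mult.commute)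
      qed
      show "continuous_on {a..b} (\<lambda>r. a ^ N * (speed r * ?b r))"
        by (intro continuous_on_mult continuous_on_const csp cb)
    qed
    also have "\<dots> = a ^ N * (L / 12012)"
      using L0 by (simp add: ab(5) \<alpha>_def bump_primitive_0_1)
    finally have "a ^ N * (L / 12012) = (LINT r:{a..b}|lborel. a ^ N * (speed r * ?b r))" by (rule sym)
    also have "\<dots> \<le> (LINT r:{a..b}|lborel. r ^ N * (speed r * (norm (H (arc_length r)))\<^sup>2))"
    proof (rule set_integral_mono)
      show "set_integrable lborel {a..b} (\<lambda>r. a ^ N * (speed r * ?b r))"
        by (intro integrable continuous_on_mult continuous_on_const csp cb)
      show "set_integrable lborel {a..b} (\<lambda>r. r ^ N * (speed r * (norm (H (arc_length r)))\<^sup>2))"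
        by (intro integrable continuous_intros csp comp cH)
      show "a ^ N * (speed r * ?b r) \<le> r ^ N * (speed r * (norm (H (arc_length r)))\<^sup>2)" if "r \<in> {a..b}" for r
      proof -
        have "(norm (H (arc_length r)))\<^sup>2 = ?b r" by (simp add: H_def norm_packet[OF L0])
        moreover have "a ^ N \<le> r ^ N" using that a0 by (intro power_mono) auto
        moreover have "0 \<le> speed r * ?b r" using speed_ge_1[of r] by auto
        ultimately show ?thesis by (simp only: mult_right_mono)
      qed
    qed
    finally have "A * (a ^ N * (L / 12012)) \<le> A * (LINT r:{a..b}|lborel. r ^ N * (speed r * (norm (H (arc_length r)))\<^sup>2))"
      using A by (intro mult_left_mono) auto
    also have "\<dots> = (L2_norm ?\<mu> ?u)\<^sup>2"
      unfolding A_def N_def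
      by (rule L2_norm_radial[OF a0 ab(4) cu rad4(1) comp[OF cH(1)], symmetric])
    finally show ?thesis .
  qed
  have "A * (a ^ N * (L / 12012)) \<le> C\<^sup>2 * (A * (2 ^ N * a ^ N * (M * (1 + 1 / r\<^sub>0))))"
    using lower main mult_left_mono[OF upper zero_le_power2[of C]] by linarith
  then have "(A * a ^ N) * (L / 12012) \<le> (A * a ^ N) * (C\<^sup>2 * (2 ^ N * (M * (1 + 1 / r\<^sub>0))))"
    by (simp only: mult_ac)
  then have "L / 12012 \<le> C\<^sup>2 * (2 ^ N * (M * (1 + 1 / r\<^sub>0)))"
    by (rule mult_left_le_imp_le) (simp add: A a0)
  then have "L \<le> B" by (simp add: B_def mult.commute)
  then show False by (simp add: L_def)
qed

lemma arc_length_interval: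
  assumes "0 < a" "a \<le> t" "t \<in> radii" "arc_length a + L \<le> arc_length t" "L \<ge> 0"
  obtains b where "a \<le> b" "b \<le> t" "b \<in> radii" "arc_length b = arc_length a + L"
proof -
  have sub: "{a..t} \<subseteq> radii_pos"
    using radii_interval[OF assms(3)] assms(1) by (auto simp: radii_pos_def)
  have "\<exists>b\<ge>a. b \<le> t \<and> arc_length b = arc_length a + L"
    by (rule IVT') (use assms continuous_on_subset[OF continuous_arc_length sub] in auto)
  then show ?thesis using that sub by (auto simp: radii_pos_def)
qed

text \<open>Since \<open>speed\<close> is at least 1, arc length minus radius is nondecreasing. This
  produces long windows in the whole space.\<close>

lemma arc_length_increment:
  assumes "0 < a" "a \<le> t" "t \<in> radii"
  shows "t - a \<le> arc_length t - arc_length a"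
proof -
  have "arc_length a - a \<le> arc_length t - t"
  proof (rule DERIV_nonneg_imp_nondecreasing[OF assms(2)])
    fix r assume r: "a \<le> r" "r \<le> t"
    then have "r \<in> radii" using radii_interval[OF assms(3)] assms(1) by auto
    then have "((\<lambda>r. arc_length r - r) has_real_derivative speed r - 1) (at r)"
      using r assms(1) by (intro DERIV_diff arc_length_has_derivative DERIV_ident) auto
    then show "\<exists>y. ((\<lambda>r. arc_length r - r) has_real_derivative y) (at r) \<and> 0 \<le> y"
      using speed_ge_1[of r] by (intro exI[of _ "speed r - 1"]) auto
  qed
  then show ?thesis by simp
qed

end

theorem theorem1:
  fixes D :: "(real^'n::finite) set" and f :: "real^'n \<Rightarrow> real"
  assumes "D = UNIV \<or> (\<exists>R>0. D = ball 0 R)"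
    and "smooth_on D f"
    and "radial_on D f"
    and "geodesically_complete D (graph_map f)"
  shows "laplace_spectrum D (graph_map f) = {0..}"
proof -
  interpret radial_graph D f
  proof
    show "open D" "0 \<in> D" using assms(1) by auto
    show "y \<in> D" if "x \<in> D" "norm y \<le> norm x" for x y
      using assms(1) that by auto
  qed (use assms in auto)
  obtain r\<^sub>0 where r0: "r\<^sub>0 > 0" and windows: "\<And>L. L \<ge> 1 \<Longrightarrow>
      \<exists>a b. r\<^sub>0 \<le> a \<and> a \<le> b \<and> b \<le> 2 * a \<and> b \<in> radii \<and> arc_length b = arc_length a + L"
  proof (cases "D = UNIV")
    case True
    have "\<exists>a b. 1 \<le> a \<and> a \<le> b \<and> b \<le> 2 * a \<and> b \<in> radii \<and> arc_length b = arc_length a + L" if L: "L \<ge> 1" for L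
    proof -
      \<comment> \<open>The window starts at radius \<open>L\<close>: up to radius
        \<open>2 * L\<close> the arc length grows by at least \<open>L\<close>, so the increment
        \<open>L\<close> is attained before the radius has doubled. As \<open>L \<ge> 1\<close>, the
        bound \<open>r\<^sub>0 = 1\<close> works.\<close>
      have "2 * L \<in> radii" unfolding radii_def using True by blast
      then obtain b where "L \<le> b" "b \<le> 2 * L" "b \<in> radii" "arc_length b = arc_length L + L"
        using arc_length_interval[of L "2 * L" L] arc_length_increment[of L "2 * L"] L by auto
      then show ?thesis using L by blast
    qed
    then show ?thesis by (intro that[of 1]) auto
  next
    case False
    then obtain R where R: "R > 0" "D = ball 0 R" using assms(1) by blast
    have "x \<in> D \<longleftrightarrow> norm x < R" for x using R(2) by auto
    then have radii: "t \<in> radii \<longleftrightarrow> \<bar>t\<bar> < R" for t by (simp add: radii_def)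
    have "\<exists>a b. R / 2 \<le> a \<and> a \<le> b \<and> b \<le> 2 * a \<and> b \<in> radii \<and> arc_length b = arc_length a + L" if L: "L \<ge> 1" for L
    proof -
      \<comment> \<open>Completeness enters here: beyond \<open>R / 2\<close> there is room for
        every \<open>L\<close>. The doubling condition is automatic, since all radii are below
        \<open>R = 2 * (R / 2)\<close>.\<close>
      obtain t where t: "t \<in> radii" "0 < t" "arc_length (R / 2) + L \<le> arc_length t"
        using complete_imp_arc_length_unbounded[OF assms(4)] .
      have "R / 2 \<le> t"
      proof (rule ccontr)
        assume "\<not> R / 2 \<le> t"
        then have "arc_length t \<le> arc_length (R / 2)"
          using t(2) R(1) radii by (intro arc_length_mono) auto
        then show False using t(3) L by simp
      qed
      then obtain b where "R / 2 \<le> b" "b \<le> t" "b \<in> radii" "arc_length b = arc_length (R / 2) + L"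
        using arc_length_interval[of "R / 2" t L] t L R(1) by auto
      moreover have "b \<le> 2 * (R / 2)" using \<open>b \<le> t\<close> t(1) radii by auto
      ultimately show ?thesis by blast
    qed
    then show ?thesis using R(1) by (intro that[of "R / 2"]) auto
  qed
  \<comment> \<open>The spectrum is by definition a set of nonnegative reals, so it remains that no
    \<open>l \<ge> 0\<close> admits a bounded inverse.\<close>
  show ?thesis
    unfolding laplace_spectrum_def using no_bounded_inverse[OF r0 windows] by auto
qed

end
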